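(* Let $0<c<1$, $Z>0$, $K>0$ and $Y=\frac{2cZ}{1+c}$. There is a constant $C$ depending only on $c$, $Z$ and $K$ such that, whenever $\beta,\tilde\beta\in\dot C^1[0,Z]$ satisfy $\|\beta\|_{L^2[0,Z]}^2\le K$ and $\|\tilde\beta\|_{L^2[0,Z]}^2\le K$, and $\mathbf M,\tilde{\mathbf M}$ are the solutions of the impulsive initial boundary value problem (see context) corresponding to $\beta,\tilde\beta$ respectively, one has $$\|\beta-\tilde\beta\|_{L^2[0,Y]}^2\le C\left(\|(M_1-\tilde M_1)(0,\cdot)\|_{L^2[0,2Z]}^2+\|(M_3-\tilde M_3)(0,\cdot)\|_{L^2[0,2Z]}^2\right).$$
   Context: $\dot C^1[0,Z]=\{\beta\in C^1[0,Z] : \beta(0)=0,\ \beta'(0)=0\}$ (real valued functions). The matrices are $$A=\mathrm{diag}(1,-1,c,-c),\qquad B=\frac12\begin{bmatrix}0&0&-1-c&-1+c\\0&0&1-c&1+c\\1+c&-1+c&0&0\\1-c&-1-c&0&0\end{bmatrix}.$$ The impulsive initial boundary value problem for $\mathbf M=[M_1,M_2,M_3,M_4]^T$ is: $\mathbf M_t=A\mathbf M_z+\beta B\mathbf M$ for $z\ge0$, $t\in\mathbb R$; $M_2(0,t)=\delta(t)$ and $M_4(0,t)=0$ for $t\in\mathbb R$; $\mathbf M(z,t)=\mathbf 0$ for $t<0$, $z\ge0$. For $\beta\in\dot C^1[0,Z]$ its unique solution on the region $0\le z\le Z$, $z+t\le 2Z$ is $$\mathbf M(z,t)=\delta(t-z)[0,1,0,0]^T+\mathbf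 m(z,t)H(t-z)$$ ($\delta$ the Dirac delta, $H$ the Heaviside function), where $\mathbf m$ is the unique $C^1$ solution of: $\mathbf m_t=A\mathbf m_z+\beta B\mathbf m$ on $0\le z\le t\le 2Z-z$; $m_2(0,t)=m_4(0,t)=0$ for $0\le t\le 2Z$; $m_1(z,z)=0$, $m_3(z,z)=\frac{c-1}{2(c+1)}\beta(z)$, $m_4(z,z)=\frac{c+1}{2(c-1)}\beta(z)$ for $0\le z\le Z$. Thus $M_1(0,t)=m_1(0,t)$ and $M_3(0,t)=m_3(0,t)$ for $t\in[0,2Z]$, and the norms on the right-hand side are norms of these $C^1$ functions. *)

theory Defs
  imports "HOL-Analysis.Analysis"
begin

definition L2_norm_on :: "real \<Rightarrow> real \<Rightarrow> (real \<Rightarrow> real) \<Rightarrow> real" where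
  "L2_norm_on a b f = sqrt (integral {a..b} (\<lambda>x. (f x)\<^sup>2))"

(* Derivatives at 0 and Z are one-sided. Values of a function outside {0..Z} are irrelevant,
   which is why C1_differentiable_on (two-sided derivatives) is not used. *)
definition C1_dot :: "real \<Rightarrow> (real \<Rightarrow> real) set" where
  "C1_dot Z = {\<beta>. \<exists>\<beta>'. continuous_on {0..Z} \<beta>' \<and>
      (\<forall>z\<in>{0..Z}. (\<beta> has_real_derivative \<beta>' z) (at z within {0..Z})) \<and>
      \<beta> 0 = 0 \<and> \<beta>' 0 = 0}"

definition matA :: "real \<Rightarrow> real^4^4" where
  "matA c = vector [vector [1,  0, 0,  0],
                    vector [0, -1, 0,  0],
                    vector [0,  0, c,  0],
                    vector [0,  0, 0, -c]]"

definition matB :: "real \<Rightarrow> real^4^4" where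
  "matB c = (1/2) *\<^sub>R vector [vector [0,     0,      -1 - c, -1 + c],
                              vector [0,     0,       1 - c,  1 + c],
                              vector [1 + c, -1 + c,  0,      0],
                              vector [1 - c, -1 - c,  0,      0]]"

definition triangle :: "real \<Rightarrow> (real \<times> real) set" where
  "triangle Z = {(z, t). 0 \<le> z \<and> z \<le> t \<and> t \<le> 2 * Z - z}"

(* Continuously differentiable up to the boundary. *)
definition C1_on_triangle :: "real \<Rightarrow> (real \<times> real \<Rightarrow> real^4) \<Rightarrow> bool" where
  "C1_on_triangle Z m \<longleftrightarrow>
     (\<exists>mz mt. continuous_on (triangle Z) mz \<and> continuous_on (triangle Z) mt \<and>
        (\<forall>p\<in>triangle Z. (m has_derivative (\<lambda>(h, k). h *\<^sub>R mz p + k *\<^sub>R mt p))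
                           (at p within triangle Z)))"

(* Test functions in t: continuously differentiable, with compact support in (-\<infinity>, a).
   As only distributions of order 0 in t and their t-derivatives are paired with them,
   this gives the same notion of solution as smooth test functions. *)
definition test_functions :: "real \<Rightarrow> (real \<Rightarrow> real) set" where
  "test_functions a = {\<phi>. \<phi> C1_differentiable_on UNIV \<and>
      (\<exists>S T. T < a \<and> (\<forall>t. t \<le> S \<or> T \<le> t \<longrightarrow> \<phi> t = 0))}"

(* A vector field M(z,t) that is a distribution in t for every z is represented by its
   pairings: M z \<phi> stands for the integral of \<phi>(t) M(z,t) over t.
   On the region 0 \<le> z \<le> Z, z + t \<le> 2Z only test functions supported in t < 2Z - z
   are admitted at z. The derivative in t is the distributional one, so that the PDE, paired
   with \<phi> and written as A M_z = M_t - \<beta> B M, is the first clause. The traces of M at z = 0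
   make sense as M is differentiable in z. *)
definition impulsive_ibvp ::
    "real \<Rightarrow> real \<Rightarrow> (real \<Rightarrow> real) \<Rightarrow> (real \<Rightarrow> (real \<Rightarrow> real) \<Rightarrow> real^4) \<Rightarrow> bool" where
  "impulsive_ibvp c Z \<beta> M \<longleftrightarrow>
     (\<forall>z\<in>{0..Z}. \<forall>\<phi>\<in>test_functions (2 * Z - z).
        ((\<lambda>w. matA c *v M w \<phi>) has_vector_derivative
           - M z (deriv \<phi>) - \<beta> z *\<^sub>R (matB c *v M z \<phi>)) (at z within {0..Z})) \<and>
     (\<forall>\<phi>\<in>test_functions (2 * Z). M 0 \<phi> $ 2 = \<phi> 0 \<and> M 0 \<phi> $ 4 = 0) \<and>
     (\<forall>z\<in>{0..Z}. \<forall>\<phi>\<in>test_functions (min 0 (2 * Z - z)). M z \<phi> = 0)"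

(* M(z,t) = \<delta>(t - z) [0,1,0,0]^T + m(z,t) H(t - z) *)
definition impulsive_field ::
    "real \<Rightarrow> (real \<times> real \<Rightarrow> real^4) \<Rightarrow> real \<Rightarrow> (real \<Rightarrow> real) \<Rightarrow> real^4" where
  "impulsive_field Z m z \<phi> =
     \<phi> z *\<^sub>R vector [0, 1, 0, 0] + integral {z..2 * Z - z} (\<lambda>t. \<phi> t *\<^sub>R m (z, t))"

(* The solution M of the impulsive problem is handled through its regular part m; in particular
   M_1(0,t) = m_1(0,t) and M_3(0,t) = m_3(0,t) for 0 \<le> t \<le> 2Z.
   For M of this form and m continuously differentiable, the impulsive problem amounts to
   m_t = A m_z + \<beta> B m on the triangle, m_2 = m_4 = 0 at z = 0, and, collecting the terms
   in \<delta>(t - z), (I + A) m(z,z) = \<beta>(z) B [0,1,0,0]^T. *)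
definition impulsive_solution ::
    "real \<Rightarrow> real \<Rightarrow> (real \<Rightarrow> real) \<Rightarrow> (real \<times> real \<Rightarrow> real^4) \<Rightarrow> bool" where
  "impulsive_solution c Z \<beta> m \<longleftrightarrow>
     C1_on_triangle Z m \<and> impulsive_ibvp c Z \<beta> (impulsive_field Z m)"

end

theory Submission imports Defs
begin

text \<open>
  Why the theorem is true. The unknown depth \<open>z\<close> is treated as the evolution variable. Since
  \<open>matA c\<close> is invertible, the system can be solved for the \<open>z\<close>-derivative, and \<open>m (0, t)\<close> is
  its Cauchy datum: two components of it are the measured ones, the other two vanish. Along the
  front \<open>t = z\<close> the regular part carries the coefficient itself, because there \<open>m $ 3\<close> and
  \<open>m $ 4\<close> are fixed multiples of \<open>\<beta>\<close>. An energy estimate marching in \<open>z\<close> therefore bounds the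
  coefficient by the data, provided that the front contributes to the energy balance with
  the right sign.

  Let \<open>w\<close> be the difference of two solutions and \<open>b\<close> the difference of their coefficients. The
  energy is the integral of a weighted sum of squares of the components of \<open>w\<close> over
  \<open>z \<le> t \<le> 2 * Z - z / c\<close>. The upper end moves with the slowest speed of the system, so that
  nothing enters from above; the segment shrinks to a point exactly at depth
  \<open>2 * c * Z / (1 + c)\<close>, which is why the estimate stops there. At the lower end, which is the
  front, the slow wave \<open>w $ 4\<close> feeds energy into the segment, and \<open>w $ 3\<close> takes energy out of
  it. Both are multiples of \<open>b\<close>, and a large weight on the third component makes the balance
  equal to \<open>- b\<^sup>2\<close> (\<open>lateral_weight_balance\<close>). The system for \<open>w\<close> has the source
  \<open>b * B m\<close>; Young's inequality absorbs its share of \<open>b\<^sup>2\<close> at the price of a growth rate that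
  involves the integral \<open>N z\<close> of \<open>(norm (m (z, t)))\<^sup>2\<close> over the fibre (\<open>lateral_energy_inequality\<close>).
  Gronwall's argument (\<open>gronwall_dissipation\<close>) then yields the estimate, with a constant that
  depends on the solutions only through the integrals of \<open>\<beta>\<^sup>2\<close> and of \<open>N\<close>.

  The integral of \<open>N\<close> over \<open>z\<close>, which is the square of the norm of \<open>m\<close> in \<open>L\<^sup>2\<close> of the triangle, is
  controlled by \<open>K\<close> alone, because \<open>matB c\<close> is antisymmetric: whatever the coefficient is, the
  forward evolution in \<open>t\<close> creates no energy inside the triangle, and only the front supplies it
  (\<open>regular_part_L2_bound\<close>).

  All this is applied to classical solutions. The distributional formulation is reduced
  to the classical one by testing with explicit bump functions on each fibre
  (\<open>impulsive_solution_classical\<close>).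
\<close>

section \<open>Continuously differentiable functions and integrals over fibres of the triangle\<close>

text \<open>
  The partial derivatives are explicit arguments: they appear as integrands, and at the corners and
  edges of the set the derivative within the set need not determine them.
\<close>

definition C1_with :: "(real \<times> real) set \<Rightarrow> (real \<times> real \<Rightarrow> 'a::real_normed_vector)
    \<Rightarrow> (real \<times> real \<Rightarrow> 'a) \<Rightarrow> (real \<times> real \<Rightarrow> 'a) \<Rightarrow> bool" where
  "C1_with S f fz ft \<longleftrightarrow> continuous_on S fz \<and> continuous_on S ft \<and>
     (\<forall>p\<in>S. (f has_derivative (\<lambda>(h, k). h *\<^sub>R fz p + k *\<^sub>R ft p)) (at p within S))"

lemma C1_with_continuous:
  assumes "C1_with S f fz ft"
  shows "continuous_on S f" "continuous_on S fz" "continuous_on S ft"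
  using assms unfolding C1_with_def
  by (auto intro: has_derivative_continuous_on)

lemma C1_with_along_curve:
  fixes f :: "real \<times> real \<Rightarrow> real"
  assumes f: "C1_with S f fz ft" and x: "x \<in> U" and US: "\<And>y. y \<in> U \<Longrightarrow> (g y, h y) \<in> S"
    and g: "(g has_real_derivative g') (at x within U)"
    and h: "(h has_real_derivative h') (at x within U)"
  shows "((\<lambda>y. f (g y, h y)) has_real_derivative g' * fz (g x, h x) + h' * ft (g x, h x)) (at x within U)"
proof -
  have 1: "((\<lambda>y. (g y, h y)) has_derivative (\<lambda>d. (g' * d, h' * d))) (at x within U)"
    using has_derivative_Pair[OF g[unfolded has_field_derivative_def] h[unfolded has_field_derivative_def]] .
  have 2: "(f has_derivative (\<lambda>(a, b). a *\<^sub>R fz (g x, h x) + b *\<^sub>R ft (g x, h x)))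
      (at (g x, h x) within S)"
    using f x US unfolding C1_with_def by blast
  have 3: "(f has_derivative (\<lambda>(a, b). a *\<^sub>R fz (g x, h x) + b *\<^sub>R ft (g x, h x)))
      (at (g x, h x) within (\<lambda>y. (g y, h y)) ` U)"
    by (rule has_derivative_subset[OF 2]) (use US in auto)
  show ?thesis
    using has_derivative_in_compose[OF 1 3]
    by (auto simp: has_field_derivative_def split_beta algebra_simps elim!: has_derivative_eq_rhs)
qed

lemma C1_with_component:
  fixes f :: "real \<times> real \<Rightarrow> real^'n"
  assumes "C1_with S f fz ft"
  shows "C1_with S (\<lambda>p. f p $ i) (\<lambda>p. fz p $ i) (\<lambda>p. ft p $ i)"
  using assms unfolding C1_with_def
  by (auto intro!: continuous_intros bounded_linear.has_derivative[OF bounded_linear_vec_nth, THEN has_derivative_eq_rhs]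
      simp: fun_eq_iff)

lemma C1_with_diff:
  assumes "C1_with S f fz ft" "C1_with S g gz gt"
  shows "C1_with S (\<lambda>p. f p - g p) (\<lambda>p. fz p - gz p) (\<lambda>p. ft p - gt p)"
  using assms unfolding C1_with_def
  by (auto intro!: continuous_intros has_derivative_diff[THEN has_derivative_eq_rhs]
      simp: fun_eq_iff algebra_simps)

lemma C1_with_sum:
  assumes "\<And>i. i \<in> I \<Longrightarrow> C1_with S (f i) (fz i) (ft i)"
  shows "C1_with S (\<lambda>p. \<Sum>i\<in>I. f i p) (\<lambda>p. \<Sum>i\<in>I. fz i p) (\<lambda>p. \<Sum>i\<in>I. ft i p)"
  using assms unfolding C1_with_def
  by (auto intro!: continuous_intros has_derivative_sum[THEN has_derivative_eq_rhs]
      simp: fun_eq_iff sum.distrib scaleR_sum_right)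

lemma C1_with_mult:
  fixes f :: "real \<times> real \<Rightarrow> real"
  assumes "C1_with S f fz ft" "C1_with S g gz gt"
  shows "C1_with S (\<lambda>p. f p * g p) (\<lambda>p. f p * gz p + fz p * g p) (\<lambda>p. f p * gt p + ft p * g p)"
proof -
  note c = C1_with_continuous[OF assms(1)] C1_with_continuous[OF assms(2)]
  show ?thesis
    using assms c unfolding C1_with_def
    by (auto intro!: continuous_intros has_derivative_mult[THEN has_derivative_eq_rhs]
      simp: fun_eq_iff algebra_simps)
qed

lemma C1_with_time_function:
  assumes "\<And>t. (h has_real_derivative h' t) (at t)" "continuous_on UNIV h'"
  shows "C1_with S (\<lambda>p. h (snd p)) (\<lambda>p. 0) (\<lambda>p. h' (snd p))"
proof -
  have "((\<lambda>p. h (snd p)) has_derivative (\<lambda>d. h' (snd p) * snd d)) (at p within S)" for p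
    using has_derivative_in_compose[OF has_derivative_snd[OF has_derivative_ident]
        has_derivative_at_withinI[OF assms(1)[of "snd p", unfolded has_field_derivative_def]]]
    by simp
  then have "((\<lambda>p. h (snd p)) has_derivative (\<lambda>(a, b). a *\<^sub>R 0 + b *\<^sub>R h' (snd p))) (at p within S)" for p
    by (rule has_derivative_eq_rhs) (auto simp: fun_eq_iff)
  then show ?thesis unfolding C1_with_def
    by (auto intro!: continuous_intros continuous_on_compose2[OF assms(2)])
qed

lemma fibre_in_triangle:
  assumes "1 \<le> s" "0 \<le> z" "z \<le> 2 * Z / (1 + s)" "z \<le> t" "t \<le> 2 * Z - s * z"
  shows "(z, t) \<in> triangle Z"
proof -
  have "z \<le> s * z" using assms by (simp add: mult_le_cancel_right1)
  then show ?thesis using assms by (auto simp: triangle_def)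
qed

lemma continuous_on_fibre:
  assumes f: "continuous_on (triangle Z) f" and "1 \<le> s" "0 \<le> z"
  shows "continuous_on {z..2 * Z - s * z} (\<lambda>t. f (z, t))"
proof -
  have "z \<le> s * z" using assms by (simp add: mult_le_cancel_right1)
  then show ?thesis
    by (intro continuous_on_compose2[OF f] continuous_intros)
       (use assms in \<open>auto simp: triangle_def\<close>)
qed

text \<open>
  The moving limits are removed by writing \<open>t = z + \<tau> * L z\<close>, where \<open>L z\<close> is the length of the
  segment; the integral then runs over the fixed interval \<open>{0..1}\<close>, where differentiation under the
  integral sign applies. The terms in the \<open>t\<close>-derivative that the substitution creates form an exact
  \<open>\<tau>\<close>-derivative and give the two boundary terms. Only values inside the triangle are used, so that
  the formula holds up to the ends of the \<open>z\<close>-interval, where the segment may be a point.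
\<close>

lemma deriv_fibre_integral:
  fixes q :: "real \<times> real \<Rightarrow> real"
  assumes q: "C1_with (triangle Z) q qz qt" and s: "1 \<le> s" and z: "z \<in> {0..2 * Z / (1 + s)}"
  shows "((\<lambda>z. integral {z..2 * Z - s * z} (\<lambda>t. q (z, t))) has_real_derivative
      integral {z..2 * Z - s * z} (\<lambda>t. qz (z, t)) - s * q (z, 2 * Z - s * z) - q (z, z))
      (at z within {0..2 * Z / (1 + s)})"
proof -
  let ?U = "{0..2 * Z / (1 + s)}"
  define L where "L = (\<lambda>z. 2 * Z - (1 + s) * z)"
  define \<theta> where "\<theta> = (\<lambda>z \<tau>. z + \<tau> * L z)"
  have L0: "0 \<le> L z" if "z \<in> ?U" for z
    using that s by (auto simp: L_def field_simps)
  have \<theta>0: "\<theta> z 0 = z" and \<theta>1: "\<theta> z 1 = 2 * Z - s * z" for z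
    by (auto simp: \<theta>_def L_def algebra_simps)
  have range: "\<theta> z \<tau> \<in> {z..2 * Z - s * z}" if "z \<in> ?U" "\<tau> \<in> {0..1}" for z \<tau>
  proof -
    have "0 \<le> \<tau> * L z" "\<tau> * L z \<le> 1 * L z"
      using that L0[OF that(1)] by (auto intro!: mult_left_le_one_le)
    then show ?thesis by (auto simp: \<theta>_def L_def algebra_simps)
  qed
  have tri: "(z, \<theta> z \<tau>) \<in> triangle Z" if "z \<in> ?U" "\<tau> \<in> {0..1}" for z \<tau>
    using range[OF that] that s by (intro fibre_in_triangle[of s]) auto
  have subst: "((\<lambda>\<tau>. L z * f (z, \<theta> z \<tau>)) has_integral integral {z..2 * Z - s * z} (\<lambda>t. f (z, t))) {0..1}"
    if f: "continuous_on (triangle Z) f" and z: "z \<in> ?U" for f :: "real \<times> real \<Rightarrow> real" and z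
  proof -
    have "((\<lambda>\<tau>. L z *\<^sub>R f (z, \<theta> z \<tau>)) has_integral integral {\<theta> z 0..\<theta> z 1} (\<lambda>t. f (z, t))) {0..1}"
    proof (rule has_integral_substitution)
      show "\<theta> z ` {0..1} \<subseteq> {z..2 * Z - s * z}" using range[OF z] by auto
      show "continuous_on {z..2 * Z - s * z} (\<lambda>t. f (z, t))"
        using continuous_on_fibre[OF f s] z by auto
      show "\<theta> z 0 \<le> \<theta> z 1" using L0[OF z] by (simp add: \<theta>_def)
      show "(\<theta> z has_real_derivative L z) (at x within {0..1})" for x
        unfolding \<theta>_def by (auto intro!: derivative_eq_intros)
    qed simp
    then show ?thesis by (simp add: \<theta>0 \<theta>1)
  qed
  note qc = C1_with_continuous[OF q]
  define dq where "dq = (\<lambda>z \<tau>. (qz (z, \<theta> z \<tau>) + (1 - (1 + s) * \<tau>) * qt (z, \<theta> z \<tau>)) * L z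
      - (1 + s) * q (z, \<theta> z \<tau>))"
  have cont\<theta>: "continuous_on (?U \<times> cbox 0 1) (\<lambda>p. f (fst p, \<theta> (fst p) (snd p)))"
    if f: "continuous_on (triangle Z) f" for f :: "real \<times> real \<Rightarrow> real"
  proof (rule continuous_on_compose2[OF f])
    show "continuous_on (?U \<times> cbox 0 1) (\<lambda>p. (fst p, \<theta> (fst p) (snd p)))"
      unfolding \<theta>_def L_def by (intro continuous_intros)
  qed (use tri in auto)
  have D: "((\<lambda>z. integral (cbox 0 1) (\<lambda>\<tau>. L z * q (z, \<theta> z \<tau>))) has_field_derivative
      integral (cbox 0 1) (dq z)) (at z within ?U)"
  proof (rule leibniz_rule_field_derivative[OF _ _ _ z])
    fix x \<tau> :: real assume x: "x \<in> ?U" and \<tau>: "\<tau> \<in> cbox 0 1"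
    have "((\<lambda>x. \<theta> x \<tau>) has_real_derivative 1 - (1 + s) * \<tau>) (at x within ?U)"
      unfolding \<theta>_def L_def by (auto intro!: derivative_eq_intros simp: algebra_simps)
    then have "((\<lambda>x. q (x, \<theta> x \<tau>)) has_real_derivative
        1 * qz (x, \<theta> x \<tau>) + (1 - (1 + s) * \<tau>) * qt (x, \<theta> x \<tau>)) (at x within ?U)"
      by (intro C1_with_along_curve[OF q x]) (use tri \<tau> in auto)
    moreover have "(L has_real_derivative - (1 + s)) (at x within ?U)"
      unfolding L_def by (auto intro!: derivative_eq_intros)
    ultimately show "((\<lambda>x. L x * q (x, \<theta> x \<tau>)) has_real_derivative dq x \<tau>) (at x within ?U)"
      by (auto intro!: derivative_eq_intros simp: dq_def algebra_simps)
  next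
    fix x assume "x \<in> ?U"
    then show "(\<lambda>\<tau>. L x * q (x, \<theta> x \<tau>)) integrable_on cbox 0 1"
      using subst[OF qc(1)] by auto
  next
    show "continuous_on (?U \<times> cbox 0 1) (\<lambda>(x, \<tau>). dq x \<tau>)"
      unfolding dq_def split_beta L_def
      by (intro continuous_intros cont\<theta>[OF qc(1)] cont\<theta>[OF qc(2)] cont\<theta>[OF qc(3)])
  qed simp
  \<comment> \<open>The factor \<open>1 - (1 + s) * \<tau>\<close> is the \<open>z\<close>-derivative of \<open>\<theta> z \<tau>\<close>, and \<open>- (1 + s)\<close> is that of \<open>L\<close>.\<close>
  have FTC: "((\<lambda>\<tau>. (1 - (1 + s) * \<tau>) * qt (z, \<theta> z \<tau>) * L z - (1 + s) * q (z, \<theta> z \<tau>)) has_integral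
      (1 - (1 + s) * 1) * q (z, \<theta> z 1) - (1 - (1 + s) * 0) * q (z, \<theta> z 0)) {0..1}"
  proof (rule fundamental_theorem_of_calculus)
    fix \<tau> :: real assume \<tau>: "\<tau> \<in> {0..1}"
    have "((\<lambda>\<tau>. q (z, \<theta> z \<tau>)) has_real_derivative 0 * qz (z, \<theta> z \<tau>) + L z * qt (z, \<theta> z \<tau>))
        (at \<tau> within {0..1})"
      by (rule C1_with_along_curve[OF q \<tau>])
         (use tri z in \<open>auto simp: \<theta>_def intro!: derivative_eq_intros\<close>)
    then show "((\<lambda>\<tau>. (1 - (1 + s) * \<tau>) * q (z, \<theta> z \<tau>)) has_vector_derivative
        (1 - (1 + s) * \<tau>) * qt (z, \<theta> z \<tau>) * L z - (1 + s) * q (z, \<theta> z \<tau>)) (at \<tau> within {0..1})"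
      unfolding has_real_derivative_iff_has_vector_derivative[symmetric]
      by (auto intro!: derivative_eq_intros simp: algebra_simps)
  qed simp
  have "(dq z has_integral integral {z..2 * Z - s * z} (\<lambda>t. qz (z, t)) - s * q (z, 2 * Z - s * z) - q (z, z)) {0..1}"
    using has_integral_add[OF subst[OF qc(2) z] FTC]
    by (simp add: dq_def \<theta>0 \<theta>1 algebra_simps)
  then have "integral (cbox 0 1) (dq z) = integral {z..2 * Z - s * z} (\<lambda>t. qz (z, t)) - s * q (z, 2 * Z - s * z) - q (z, z)"
    by (simp add: integral_unique)
  with D have "((\<lambda>z. integral {0..1} (\<lambda>\<tau>. L z * q (z, \<theta> z \<tau>))) has_real_derivative
      integral {z..2 * Z - s * z} (\<lambda>t. qz (z, t)) - s * q (z, 2 * Z - s * z) - q (z, z)) (at z within ?U)"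
    by simp
  then show ?thesis
    by (rule has_field_derivative_transform_within[OF _ zero_less_one z])
       (simp add: integral_unique[OF subst[OF qc(1)]] del: integral_mult_right)
qed

lemma has_integral_fibre_derivative:
  assumes f: "C1_with (triangle Z) f fz ft" and s: "1 \<le> s" "0 \<le> z" "z \<le> 2 * Z / (1 + s)"
  shows "((\<lambda>t. ft (z, t)) has_integral (f (z, 2 * Z - s * z) - f (z, z :: real) :: real)) {z..2 * Z - s * z}"
proof (rule fundamental_theorem_of_calculus)
  show "z \<le> 2 * Z - s * z" using s by (auto simp: field_simps)
  fix t assume t: "t \<in> {z..2 * Z - s * z}"
  have "((\<lambda>t. f (z, t)) has_real_derivative 0 * fz (z, t) + 1 * ft (z, t)) (at t within {z..2 * Z - s * z})"
    by (rule C1_with_along_curve[OF f t]) (use s fibre_in_triangle[of s z] in auto)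
  then show "((\<lambda>t. f (z, t)) has_vector_derivative ft (z, t)) (at t within {z..2 * Z - s * z})"
    by (simp add: has_real_derivative_iff_has_vector_derivative)
qed

section \<open>Energy identities for diagonal systems\<close>

definition weighted_sq :: "real^'n \<Rightarrow> real^'n \<Rightarrow> real" where
  "weighted_sq d x = (\<Sum>i\<in>UNIV. d $ i * (x $ i)\<^sup>2)"

lemma C1_with_weighted_sq:
  assumes "C1_with S w wz wt"
  shows "C1_with S (\<lambda>p. weighted_sq d (w p)) (\<lambda>p. \<Sum>i\<in>UNIV. 2 * d $ i * w p $ i * wz p $ i)
    (\<lambda>p. \<Sum>i\<in>UNIV. 2 * d $ i * w p $ i * wt p $ i)"
proof -
  have "C1_with S (\<lambda>p. (d $ i) * (w p $ i)\<^sup>2) (\<lambda>p. 2 * d $ i * w p $ i * wz p $ i) (\<lambda>p. 2 * d $ i * w p $ i * wt p $ i)" for i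
  proof -
    note c = C1_with_component[OF assms, of i]
    have k: "C1_with S (\<lambda>p. d $ i) (\<lambda>p. 0) (\<lambda>p. 0)"
      using C1_with_time_function[of "\<lambda>_. d $ i" "\<lambda>_. 0"] by auto
    from C1_with_mult[OF k C1_with_mult[OF c c]] show ?thesis
      by (simp add: power2_eq_square algebra_simps)
  qed
  then show ?thesis unfolding weighted_sq_def by (rule C1_with_sum)
qed

text \<open>
  For a diagonal system \<open>w\<^sub>t = a w\<^sub>z + f\<close>, multiplication by \<open>2 * e * w\<close> with \<open>e = d / a\<close> turns the
  \<open>z\<close>-derivative of the density \<open>d * w\<^sup>2\<close> into the \<open>t\<close>-derivative of the flux \<open>e * w\<^sup>2\<close>, up to the
  forcing. The factor \<open>l + k * t\<close> serves two purposes: with \<open>k = 0\<close> the identity is the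
  marching energy balance for the difference of two solutions, and with the factor \<open>2 * Z - t\<close> it
  measures a solution over the whole triangle.
\<close>

lemma energy_identity:
  fixes a d :: "real^'n" and w :: "real \<times> real \<Rightarrow> real^'n"
  assumes w: "C1_with (triangle Z) w wz wt" and s: "1 \<le> s" and z: "z \<in> {0..2 * Z / (1 + s)}"
    and a: "\<And>i. a $ i \<noteq> 0"
    and eq: "\<And>t i. t \<in> {z..2 * Z - s * z} \<Longrightarrow> wt (z, t) $ i = a $ i * wz (z, t) $ i + f t $ i"
  defines "e \<equiv> (\<chi> i. d $ i / a $ i)" and "u \<equiv> 2 * Z - s * z"
  shows "((\<lambda>z. integral {z..2 * Z - s * z} (\<lambda>t. (l + k * t) * weighted_sq d (w (z, t)))) has_real_derivative
      (l + k * u) * (weighted_sq e (w (z, u)) - s * weighted_sq d (w (z, u)))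
      - (l + k * z) * (weighted_sq e (w (z, z)) + weighted_sq d (w (z, z)))
      - integral {z..u} (\<lambda>t. k * weighted_sq e (w (z, t))
          + (l + k * t) * (\<Sum>i\<in>UNIV. 2 * e $ i * w (z, t) $ i * f t $ i)))
      (at z within {0..2 * Z / (1 + s)})"
proof -
  have h: "C1_with (triangle Z) (\<lambda>p. l + k * snd p) (\<lambda>p. 0) (\<lambda>p. k)"
    by (rule C1_with_time_function[of "\<lambda>t. l + k * t" "\<lambda>_. k"]) (auto intro!: derivative_eq_intros)
  note q = C1_with_mult[OF h C1_with_weighted_sq[OF w, of d]]
  note p = C1_with_mult[OF h C1_with_weighted_sq[OF w, of e]]
  let ?qz = "\<lambda>t. (l + k * t) * (\<Sum>i\<in>UNIV. 2 * d $ i * w (z, t) $ i * wz (z, t) $ i)"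
  let ?r = "\<lambda>t. k * weighted_sq e (w (z, t)) + (l + k * t) * (\<Sum>i\<in>UNIV. 2 * e $ i * w (z, t) $ i * f t $ i)"
  have "?qz integrable_on {z..u}"
    using integrable_continuous_real[OF continuous_on_fibre[OF C1_with_continuous(2)[OF q] s]] z
    by (auto simp: u_def)
  then have 1: "(?qz has_integral integral {z..u} ?qz) {z..u}" by auto
  have 2: "((\<lambda>t. (l + k * t) * (\<Sum>i\<in>UNIV. 2 * e $ i * w (z, t) $ i * wt (z, t) $ i) + k * weighted_sq e (w (z, t)))
     has_integral ((l + k * u) * weighted_sq e (w (z, u)) - (l + k * z) * weighted_sq e (w (z, z)))) {z..u}"
    using has_integral_fibre_derivative[OF p s] z by (auto simp: u_def)
  have "(?r has_integral ((l + k * u) * weighted_sq e (w (z, u)) - (l + k * z) * weighted_sq e (w (z, z))) - integral {z..u} ?qz) {z..u}"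
  proof (rule has_integral_eq[OF _ has_integral_diff[OF 2 1]])
    fix t assume t: "t \<in> {z..u}"
    have "2 * e $ i * w (z, t) $ i * wt (z, t) $ i - 2 * d $ i * w (z, t) $ i * wz (z, t) $ i
        = 2 * e $ i * w (z, t) $ i * f t $ i" for i
      using a[of i] eq[of t i] t by (simp add: e_def u_def field_simps)
    then have "(\<Sum>i\<in>UNIV. 2 * e $ i * w (z, t) $ i * f t $ i) = (\<Sum>i\<in>UNIV. 2 * e $ i * w (z, t) $ i * wt (z, t) $ i) - (\<Sum>i\<in>UNIV. 2 * d $ i * w (z, t) $ i * wz (z, t) $ i)"
      by (simp add: sum_subtractf[symmetric])
    then show "(l + k * t) * (\<Sum>i\<in>UNIV. 2 * e $ i * w (z, t) $ i * wt (z, t) $ i) + k * weighted_sq e (w (z, t)) - ?qz t = ?r t"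
      by (simp only: right_diff_distrib)
  qed
  then have qz: "integral {z..u} ?qz = (l + k * u) * weighted_sq e (w (z, u)) - (l + k * z) * weighted_sq e (w (z, z)) - integral {z..u} ?r"
    by (simp only: integral_unique)
  have "((\<lambda>z. integral {z..2 * Z - s * z} (\<lambda>t. (l + k * t) * weighted_sq d (w (z, t)))) has_real_derivative
      integral {z..u} ?qz - s * ((l + k * u) * weighted_sq d (w (z, u))) - (l + k * z) * weighted_sq d (w (z, z)))
      (at z within {0..2 * Z / (1 + s)})"
    using deriv_fibre_integral[OF q s z] by (simp only: u_def snd_conv mult_zero_left add_0_right)
  then show ?thesis
    by (rule DERIV_cong) (simp only: qz right_diff_distrib distrib_left mult.left_commute[of s])
qed

section \<open>From the distributional to the classical problem\<close>

text \<open>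
  The positive part of a polynomial, squared, is continuously differentiable, which makes it the
  simplest admissible test function with prescribed compact support.
\<close>

lemma DERIV_max_0_square: "((\<lambda>x::real. (max 0 x)\<^sup>2) has_real_derivative 2 * max 0 x) (at x)"
proof -
  consider "x > 0" | "x < 0" | "x = 0" by linarith
  then show ?thesis
  proof cases
    case 1
    have "((\<lambda>x. x\<^sup>2) has_real_derivative 2 * max 0 x) (at x)"
      using 1 by (auto intro!: derivative_eq_intros)
    then show ?thesis
      by (rule has_field_derivative_transform_within_open[of _ _ _ "{0<..}"]) (use 1 in auto)
  next
    case 2
    have "((\<lambda>x. 0) has_real_derivative 2 * max 0 x) (at x)"
      using 2 by (auto intro!: derivative_eq_intros)
    then show ?thesis
      by (rule has_field_derivative_transform_within_open[of _ _ _ "{..<0}"]) (use 2 in auto)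
  next
    case 3
    have "(\<lambda>h::real. (max 0 h)\<^sup>2 / h) \<midarrow>0\<rightarrow> 0"
    proof (rule Lim_null_comparison[of _ "\<lambda>h. \<bar>h\<bar>"])
      show "\<forall>\<^sub>F h in at (0::real). norm ((max 0 h)\<^sup>2 / h) \<le> \<bar>h\<bar>"
        by (rule always_eventually) (auto simp: max_def power2_eq_square)
      show "(\<lambda>h::real. \<bar>h\<bar>) \<midarrow>0\<rightarrow> 0" by (auto intro!: tendsto_eq_intros)
    qed
    then show ?thesis using 3 by (simp add: DERIV_def)
  qed
qed

definition bump :: "real \<Rightarrow> real \<Rightarrow> real \<Rightarrow> real" where
  "bump p q t = (max 0 ((t - p) * (q - t)))\<^sup>2"

lemma bump_pos: "p < t \<Longrightarrow> t < q \<Longrightarrow> 0 < bump p q t"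
  by (simp add: bump_def)

lemma bump_nonneg: "0 \<le> bump p q t"
  by (simp add: bump_def)

lemma bump_eq_0: "p \<le> q \<Longrightarrow> t \<le> p \<or> q \<le> t \<Longrightarrow> bump p q t = 0"
proof -
  assume "p \<le> q" "t \<le> p \<or> q \<le> t"
  then have "(t - p) * (q - t) \<le> 0"
    by (metis diff_ge_0_iff_ge diff_le_0_iff_le mult_nonneg_nonpos mult_nonpos_nonneg order_trans)
  then show "bump p q t = 0" by (simp add: bump_def max_def)
qed

lemma continuous_on_bump: "continuous_on A (bump p q)"
  unfolding bump_def by (intro continuous_intros)

lemma bump_test_function:
  assumes "p \<le> q" "q < b"
  shows "bump p q \<in> test_functions b"
proof -
  let ?D = "\<lambda>t. 2 * max 0 ((t - p) * (q - t)) * (p + q - 2 * t)"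
  have "((\<lambda>t. (t - p) * (q - t)) has_real_derivative p + q - 2 * t) (at t)" for t
    by (auto intro!: derivative_eq_intros)
  from DERIV_chain[OF DERIV_max_0_square this]
  have "(bump p q has_real_derivative ?D t) (at t)" for t
    by (simp add: bump_def[abs_def] o_def)
  moreover have "continuous_on UNIV ?D" by (intro continuous_intros)
  ultimately have "bump p q C1_differentiable_on UNIV"
    unfolding C1_differentiable_on_def has_real_derivative_iff_has_vector_derivative
    by (intro exI[of _ ?D]) auto
  then show ?thesis using assms bump_eq_0[OF assms(1)]
    by (auto simp: test_functions_def)
qed

text \<open>
  A test function may be nonzero at the left end \<open>a\<close>, which is where the singular front sits, but
  not at \<open>b\<close>. Bumps inside the interval show that \<open>g\<close> vanishes; once that is known, a bump
  straddling \<open>a\<close> isolates the point contribution \<open>v\<close>.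
\<close>

lemma zero_if_orthogonal_to_test_functions:
  assumes ab: "a < b" and g: "continuous_on {a..b} g"
    and int: "\<And>\<phi>. \<phi> \<in> test_functions b \<Longrightarrow> integral {a..b} (\<lambda>t. \<phi> t * g t) = \<phi> a * v"
  shows "v = 0" "\<And>t. t \<in> {a..b} \<Longrightarrow> g t = 0"
proof -
  have in0: "g t = 0" if t: "t \<in> {a<..<b}" for t
  proof (rule ccontr)
    assume nz: "g t \<noteq> 0"
    have "isCont g t" using g t by (simp add: continuous_on_interior)
    then have "((\<lambda>x. g t * g x) \<longlongrightarrow> g t * g t) (at t)"
      by (auto intro!: tendsto_intros simp: isCont_def)
    moreover have "g t * g t > 0" using nz by (auto simp: zero_less_mult_iff)
    ultimately have "\<forall>\<^sub>F x in at t. g t * g x > 0" by (rule order_tendstoD)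
    then obtain r where r: "r > 0" "\<And>x. x \<noteq> t \<Longrightarrow> dist x t < r \<Longrightarrow> g t * g x > 0"
      unfolding eventually_at by auto
    define \<delta> where "\<delta> = min r (min (t - a) (b - t)) / 2"
    have \<delta>: "\<delta> > 0" "\<delta> < r" "\<delta> < t - a" "\<delta> < b - t" using r t by (auto simp: \<delta>_def)
    let ?\<phi> = "bump (t - \<delta>) (t + \<delta>)"
    have "integral {a..b} (\<lambda>t. ?\<phi> t * g t) = 0"
      using int[OF bump_test_function, of "t - \<delta>" "t + \<delta>"] \<delta> bump_eq_0[of "t - \<delta>" "t + \<delta>" a] by auto
    then have int0: "integral {a..b} (\<lambda>x. g t * (?\<phi> x * g x)) = 0" by simp
    have cont: "continuous_on {a..b} (\<lambda>x. g t * (?\<phi> x * g x))"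
      by (intro continuous_intros continuous_on_bump g)
    have nonneg: "0 \<le> g t * (?\<phi> x * g x)" for x
    proof (cases "\<bar>x - t\<bar> < \<delta>")
      case True
      then have "g t * g x \<ge> 0"
        using r(2)[of x] \<delta> by (cases "x = t") (auto simp: dist_real_def)
      then have "0 \<le> ?\<phi> x * (g t * g x)" using mult_nonneg_nonneg[OF bump_nonneg] by blast
      then show ?thesis by (simp add: algebra_simps)
    next
      case False
      then have "x \<le> t - \<delta> \<or> t + \<delta> \<le> x" by linarith
      then show ?thesis using bump_eq_0[of "t - \<delta>" "t + \<delta>" x] \<delta> by simp
    qed
    have "\<forall>x\<in>{a..b}. g t * (?\<phi> x * g x) = 0"
      using int0 integral_eq_0_iff[OF cont ab nonneg] by blast
    then have "g t * (?\<phi> t * g t) = 0" by (rule bspec) (use t in auto)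
    then show False using nz bump_pos[of "t - \<delta>" t "t + \<delta>"] \<delta> by auto
  qed
  show 0: "g t = 0" if "t \<in> {a..b}" for t
  proof (rule continuous_constant_on_closure[of "{a<..<b}" g 0 t])
  qed (use in0 g that ab in auto)
  let ?\<phi> = "bump (a - 1) ((a + b) / 2)"
  have "integral {a..b} (\<lambda>t. ?\<phi> t * g t) = integral {a..b} (\<lambda>t. 0)"
    by (rule integral_cong) (simp add: 0)
  then have "?\<phi> a * v = 0" using int[OF bump_test_function, of "a - 1" "(a + b) / 2"] ab by auto
  then show "v = 0" using bump_pos[of "a - 1" a "(a + b) / 2"] ab by auto
qed

definition speed :: "real \<Rightarrow> real^4" where
  "speed c = vector [1, -1, c, -c]"

lemma vector_4_nth [simp]:
  "(vector [a, b, c, d] :: 'a::zero^4) $ 1 = a" "(vector [a, b, c, d] :: 'a::zero^4) $ 2 = b"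
  "(vector [a, b, c, d] :: 'a::zero^4) $ 3 = c" "(vector [a, b, c, d] :: 'a::zero^4) $ 4 = d"
  by (simp_all add: vector_def)

lemma speed_simps [simp]: "speed c $ 1 = 1" "speed c $ 2 = -1" "speed c $ 3 = c" "speed c $ 4 = -c"
  by (simp_all add: speed_def)

lemma matA_nth: "(matA c *v x) $ i = speed c $ i * x $ i"
  using exhaust_4[of i]
  by (auto simp: matA_def matrix_vector_mult_def sum_4)

abbreviation "delta_dir \<equiv> (vector [0, 1, 0, 0] :: real^4)"

lemma impulsive_field_nth:
  assumes m: "continuous_on (triangle Z) m" and \<phi>: "continuous_on UNIV \<phi>" and z: "0 \<le> z"
  shows "impulsive_field Z m z \<phi> $ i = \<phi> z * delta_dir $ i + integral {z..2 * Z - z} (\<lambda>t. \<phi> t * m (z, t) $ i)"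
    "(matB c *v impulsive_field Z m z \<phi>) $ i = \<phi> z * (matB c *v delta_dir) $ i
       + integral {z..2 * Z - z} (\<lambda>t. \<phi> t * (matB c *v m (z, t)) $ i)"
proof -
  have int: "(\<lambda>t. \<phi> t *\<^sub>R m (z, t)) integrable_on {z..2 * Z - z}"
    by (intro integrable_continuous_real continuous_intros continuous_on_fibre[OF m, of 1, simplified] 
      z continuous_on_subset[OF \<phi>]) auto
  show "impulsive_field Z m z \<phi> $ i = \<phi> z * delta_dir $ i + integral {z..2 * Z - z} (\<lambda>t. \<phi> t * m (z, t) $ i)"
    using integral_linear[OF int bounded_linear_vec_nth[of i]]
    by (simp add: impulsive_field_def o_def)
  have "bounded_linear (\<lambda>x. (matB c *v x) $ i)"
    by (intro bounded_linear_compose[OF bounded_linear_vec_nth] matrix_vector_mul_bounded_linear)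
  from integral_linear[OF int this]
  show "(matB c *v impulsive_field Z m z \<phi>) $ i = \<phi> z * (matB c *v delta_dir) $ i
       + integral {z..2 * Z - z} (\<lambda>t. \<phi> t * (matB c *v m (z, t)) $ i)"
    by (simp add: impulsive_field_def o_def matrix_vector_right_distrib matrix_vector_mult_scaleR)
qed

lemma continuous_on_matrix_vector:
  fixes f :: "'a::topological_space \<Rightarrow> real^'n"
  shows "continuous_on S f \<Longrightarrow> continuous_on S (\<lambda>x. A *v f x)"
  by (rule bounded_linear.continuous_on[OF matrix_vector_mul_bounded_linear])

text \<open>
  Both sides come from computing the \<open>z\<close>-derivative of the pairing in two ways: from the equation, and
  by differentiating the integral over the fibre. On the right stands the coefficient
  of the delta distribution on the front, on the left the residual of the equation behind it. The terms
  in the derivative of \<open>\<phi>\<close> at \<open>z\<close> cancel since \<open>delta_dir\<close> is an eigenvector of \<open>matA c\<close> with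
  eigenvalue \<open>-1\<close>, which says that the front travels with speed one. The depth \<open>z = Z\<close> is excluded:
  there every admissible test function vanishes on the fibre.
\<close>

lemma weak_form_pointwise:
  assumes m: "C1_with (triangle Z) m mz mt" and ib: "impulsive_ibvp c Z \<beta> (impulsive_field Z m)"
    and z: "0 \<le> z" "z < Z" and \<phi>: "\<phi> \<in> test_functions (2 * Z - z)"
  shows "integral {z..2 * Z - z} (\<lambda>t. \<phi> t *
      (mt (z, t) - matA c *v mz (z, t) - \<beta> z *\<^sub>R (matB c *v m (z, t))) $ i)
    = \<phi> z * (\<beta> z *\<^sub>R (matB c *v delta_dir) - m (z, z) - matA c *v m (z, z)) $ i"
proof -
  let ?D = "deriv \<phi>" and ?I = "{z..2 * Z - z}" and ?a = "speed c $ i"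
  from \<phi> obtain D where D: "\<And>t. (\<phi> has_real_derivative D t) (at t)" "continuous_on UNIV D"
    unfolding test_functions_def C1_differentiable_on_def has_real_derivative_iff_has_vector_derivative
    by blast
  have dD: "deriv \<phi> = D" by (rule ext) (rule DERIV_imp_deriv[OF D(1)])
  note D = D[folded dD]
  have c\<phi>: "continuous_on UNIV \<phi>" 
    by (rule DERIV_continuous_on[OF has_field_derivative_at_within[OF D(1)]])
  have \<phi>0: "\<phi> (2 * Z - z) = 0" using \<phi> by (auto simp: test_functions_def)
  note mc = C1_with_continuous[OF m]
  note fld = impulsive_field_nth[OF mc(1)]
  note q = C1_with_mult[OF C1_with_time_function[OF D] C1_with_component[OF m, of i]]
  have "((\<lambda>w. integral {w..2 * Z - w} (\<lambda>t. \<phi> t * m (w, t) $ i)) has_real_derivative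
      integral ?I (\<lambda>t. \<phi> t * mz (z, t) $ i) - \<phi> z * m (z, z) $ i) (at z within {0..Z})"
    using deriv_fibre_integral[OF q, of 1 z] z \<phi>0 by simp
  then have "((\<lambda>w. ?a * (\<phi> w * delta_dir $ i + integral {w..2 * Z - w} (\<lambda>t. \<phi> t * m (w, t) $ i))) has_real_derivative
      ?a * (?D z * delta_dir $ i + (integral ?I (\<lambda>t. \<phi> t * mz (z, t) $ i) - \<phi> z * m (z, z) $ i))) (at z within {0..Z})"
    by (auto intro!: derivative_eq_intros has_field_derivative_at_within[OF D(1)])
  then have 1: "((\<lambda>w. ?a * impulsive_field Z m w \<phi> $ i) has_real_derivative
      ?a * (?D z * delta_dir $ i + (integral ?I (\<lambda>t. \<phi> t * mz (z, t) $ i) - \<phi> z * m (z, z) $ i))) (at z within {0..Z})"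
    by (rule has_field_derivative_transform_within[OF _ zero_less_one]) (use z in \<open>auto simp: fld[OF c\<phi>]\<close>)
  have "((\<lambda>w. matA c *v impulsive_field Z m w \<phi>) has_vector_derivative
           - impulsive_field Z m z ?D - \<beta> z *\<^sub>R (matB c *v impulsive_field Z m z \<phi>)) (at z within {0..Z})"
    using ib z \<phi> unfolding impulsive_ibvp_def by auto
  from bounded_linear.has_vector_derivative[OF bounded_linear_vec_nth this, of i]
  have 2: "((\<lambda>w. ?a * impulsive_field Z m w \<phi> $ i) has_real_derivative
      - impulsive_field Z m z ?D $ i - \<beta> z * (matB c *v impulsive_field Z m z \<phi>) $ i) (at z within {0..Z})"
    by (simp add: matA_nth has_real_derivative_iff_has_vector_derivative)
  have "at z within {0..Z} \<noteq> bot" using z by (simp add: trivial_limit_within islimpt_Icc)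
  from has_field_derivative_unique[OF 1 2 this]
  have 3: "?a * (?D z * delta_dir $ i + (integral ?I (\<lambda>t. \<phi> t * mz (z, t) $ i) - \<phi> z * m (z, z) $ i))
    = - (?D z * delta_dir $ i + integral ?I (\<lambda>t. ?D t * m (z, t) $ i))
      - \<beta> z * (\<phi> z * (matB c *v delta_dir) $ i + integral ?I (\<lambda>t. \<phi> t * (matB c *v m (z, t)) $ i))"
    by (simp add: fld[OF c\<phi>] fld[OF D(2)] z)
  have cm: "continuous_on ?I (\<lambda>t. f (z, t))" if "continuous_on (triangle Z) f" for f :: "real \<times> real \<Rightarrow> real^4"
    using continuous_on_fibre[OF that, of 1 z] z by simp
  have i\<phi>: "(\<lambda>t. \<psi> t * g t) integrable_on ?I" if "continuous_on UNIV \<psi>" "continuous_on ?I g" for \<psi> g :: "real \<Rightarrow> real"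
    by (intro integrable_continuous_real continuous_intros that continuous_on_subset[OF that(1)]) auto
  have cB: "continuous_on ?I (\<lambda>t. (matB c *v m (z, t)) $ i)"
    by (intro continuous_intros cm mc continuous_on_matrix_vector)
  have "((\<lambda>t. \<phi> t * mt (z, t) $ i + ?D t * m (z, t) $ i) has_integral - \<phi> z * m (z, z) $ i) ?I"
    using has_integral_fibre_derivative[OF q, of 1 z] z \<phi>0 by simp
  then have 4: "integral ?I (\<lambda>t. \<phi> t * mt (z, t) $ i) + integral ?I (\<lambda>t. ?D t * m (z, t) $ i) = - \<phi> z * m (z, z) $ i"
    by (subst integral_add[symmetric]) (auto intro!: i\<phi> c\<phi> D continuous_intros cm mc simp: integral_unique)
  have "integral ?I (\<lambda>t. \<phi> t * (mt (z, t) - matA c *v mz (z, t) - \<beta> z *\<^sub>R (matB c *v m (z, t))) $ i)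
    = integral ?I (\<lambda>t. \<phi> t * mt (z, t) $ i - ?a * (\<phi> t * mz (z, t) $ i) - \<beta> z * (\<phi> t * (matB c *v m (z, t)) $ i))"
    by (simp add: matA_nth algebra_simps)
  also have "\<dots> = integral ?I (\<lambda>t. \<phi> t * mt (z, t) $ i) - ?a * integral ?I (\<lambda>t. \<phi> t * mz (z, t) $ i)
      - \<beta> z * integral ?I (\<lambda>t. \<phi> t * (matB c *v m (z, t)) $ i)"
    by (intro integral_unique has_integral_diff has_integral_mult_right integrable_integral
        i\<phi> c\<phi> continuous_intros cm cB mc)
  also have "\<dots> = \<phi> z * (\<beta> z *\<^sub>R (matB c *v delta_dir) - m (z, z) - matA c *v m (z, z)) $ i"
  proof -
    \<comment> \<open>Only \<open>i = 2\<close> matters, where the speed is \<open>-1\<close>.\<close>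
    have "?a * (?D z * delta_dir $ i) = - ?D z * delta_dir $ i"
      using exhaust_4[of i] by auto
    with 3 4 show ?thesis by (simp add: matA_nth algebra_simps)
  qed
  finally show ?thesis .
qed

lemma matB_delta_dir: "matB c *v delta_dir = vector [0, 0, (c - 1) / 2, - (1 + c) / 2]"
  by (simp add: vec_eq_iff forall_4 matB_def matrix_vector_mult_def sum_4)

text \<open>
  The trace relations on the front are the components of \<open>(I + A) m = \<beta> B delta_dir\<close>. The
  second row of \<open>I + A\<close> is zero, because the second component moves along the front; hence there is
  no condition on \<open>m $ 2\<close>.
\<close>

lemma impulsive_solution_classical:
  assumes sol: "impulsive_solution c Z \<beta> m" and c: "0 < c" "c < 1" and Z: "0 < Z"
  obtains mz mt where "C1_with (triangle Z) m mz mt"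
    "\<And>z t. 0 < z \<Longrightarrow> z < Z \<Longrightarrow> t \<in> {z..2 * Z - z} \<Longrightarrow>
       mt (z, t) = matA c *v mz (z, t) + \<beta> z *\<^sub>R (matB c *v m (z, t))"
    "\<And>z. 0 < z \<Longrightarrow> z < Z \<Longrightarrow> m (z, z) $ 1 = 0"
    "\<And>z. 0 < z \<Longrightarrow> z < Z \<Longrightarrow> m (z, z) $ 3 = (c - 1) / (2 * (c + 1)) * \<beta> z"
    "\<And>z. 0 < z \<Longrightarrow> z < Z \<Longrightarrow> m (z, z) $ 4 = (c + 1) / (2 * (c - 1)) * \<beta> z"
    "\<And>t. t \<in> {0..2 * Z} \<Longrightarrow> m (0, t) $ 2 = 0"
    "\<And>t. t \<in> {0..2 * Z} \<Longrightarrow> m (0, t) $ 4 = 0"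
proof -
  from sol obtain mz mt where m: "C1_with (triangle Z) m mz mt"
    and ib: "impulsive_ibvp c Z \<beta> (impulsive_field Z m)"
    unfolding impulsive_solution_def C1_on_triangle_def C1_with_def by blast
  note mc = C1_with_continuous[OF m]
  have cm: "continuous_on {z..2 * Z - z} (\<lambda>t. f (z, t))"
    if "continuous_on (triangle Z) f" "0 \<le> z" for f :: "real \<times> real \<Rightarrow> real^4" and z
    using continuous_on_fibre[OF that(1), of 1 z] that by simp
  have interior: "t \<in> {z..2 * Z - z} \<Longrightarrow> (mt (z, t) - matA c *v mz (z, t) - \<beta> z *\<^sub>R (matB c *v m (z, t))) $ i = 0"
    "(\<beta> z *\<^sub>R (matB c *v delta_dir) - m (z, z) - matA c *v m (z, z)) $ i = 0"
    if z: "0 < z" "z < Z" for z t i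
  proof -
    let ?g = "\<lambda>t. (mt (z, t) - matA c *v mz (z, t) - \<beta> z *\<^sub>R (matB c *v m (z, t))) $ i"
    have g: "continuous_on {z..2 * Z - z} ?g"
      by (intro continuous_intros cm mc continuous_on_matrix_vector) (use z in auto)
    note zero_if_orthogonal_to_test_functions[of z "2 * Z - z" ?g, OF _ g weak_form_pointwise[OF m ib]]
    with z show "t \<in> {z..2 * Z - z} \<Longrightarrow> ?g t = 0"
      "(\<beta> z *\<^sub>R (matB c *v delta_dir) - m (z, z) - matA c *v m (z, z)) $ i = 0" by auto
  qed
  have boundary: "m (0, t) $ i = 0" if t: "t \<in> {0..2 * Z}" and i: "i = 2 \<or> i = 4" for t i
  proof (rule zero_if_orthogonal_to_test_functions(2)[of 0 "2 * Z" _ 0, OF _ _ _ t])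
    show "continuous_on {0..2 * Z} (\<lambda>t. m (0, t) $ i)"
      using cm[OF mc(1), of 0] by (auto intro!: continuous_intros)
    fix \<phi> assume \<phi>: "\<phi> \<in> test_functions (2 * Z)"
    then have "continuous_on UNIV \<phi>"
      by (auto simp: test_functions_def intro: C1_differentiable_imp_continuous_on)
    from impulsive_field_nth(1)[OF mc(1) this, of 0 i]
    have "impulsive_field Z m 0 \<phi> $ i = \<phi> 0 * delta_dir $ i + integral {0..2 * Z} (\<lambda>t. \<phi> t * m (0, t) $ i)" by simp
    moreover have "impulsive_field Z m 0 \<phi> $ i = \<phi> 0 * delta_dir $ i"
      using ib \<phi> i Z unfolding impulsive_ibvp_def by auto
    ultimately show "integral {0..2 * Z} (\<lambda>t. \<phi> t * m (0, t) $ i) = \<phi> 0 * 0" by simp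
  qed (use Z in auto)
  show ?thesis
  proof (rule that[OF m])
    fix z t assume z: "0 < z" "z < Z" and t: "t \<in> {z..2 * Z - z}"
    show "mt (z, t) = matA c *v mz (z, t) + \<beta> z *\<^sub>R (matB c *v m (z, t))"
      using interior(1)[OF z t] by (simp add: vec_eq_iff algebra_simps)
  next
    fix z assume z: "0 < z" "z < Z"
    note jump = interior(2)[OF z, unfolded vector_minus_component vector_scaleR_component matA_nth matB_delta_dir]
    show "m (z, z) $ 1 = 0" using jump[of 1] by simp
    show "m (z, z) $ 3 = (c - 1) / (2 * (c + 1)) * \<beta> z" using jump[of 3] c by (simp add: field_simps)
    show "m (z, z) $ 4 = (c + 1) / (2 * (c - 1)) * \<beta> z" using jump[of 4] c by (simp add: field_simps)
  qed (use boundary in auto)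
qed

section \<open>Monotonicity and Gronwall estimates\<close>

lemma nondecreasing_if_deriv_nonneg:
  fixes f :: "real \<Rightarrow> real"
  assumes ab: "a \<le> b" and f: "continuous_on {a..b} f"
    and D: "\<And>x. a < x \<Longrightarrow> x < b \<Longrightarrow> \<exists>y\<ge>0. (f has_real_derivative y) (at x)"
  shows "f a \<le> f b"
proof (cases "a = b")
  case False
  with ab have "a < b" by simp
  from MVT[OF this f] D obtain l z where z: "a < z" "z < b"
    and l: "(f has_real_derivative l) (at z)" "f b - f a = (b - a) * l"
    using real_differentiable_def by blast
  from D[OF z] l(1) have "l \<ge> 0" using DERIV_unique by blast
  with l(2) \<open>a < b\<close> show ?thesis by (metis diff_ge_0_iff_ge less_imp_le mult_nonneg_nonneg)
qed simp

lemma integral_deriv_interior: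
  fixes g :: "real \<Rightarrow> real"
  assumes "continuous_on {a..b} g" "a < x" "x < b"
  shows "((\<lambda>x. integral {a..x} g) has_real_derivative g x) (at x)"
  using integral_has_real_derivative[OF assms(1), of x] assms(2,3) by (simp add: at_within_Icc_at)

text \<open>
  The energy is discounted by the growth \<open>exp (P z)\<close> accumulated so far. The dissipation is discounted by the final factor
  \<open>exp (- P b)\<close>, the smallest one, which is what turns the integral of \<open>h\<close> itself into the conclusion.
\<close>

lemma gronwall_dissipation:
  fixes E \<alpha> h :: "real \<Rightarrow> real"
  assumes ab: "a \<le> b"
    and E: "continuous_on {a..b} E" and \<alpha>: "continuous_on {a..b} \<alpha>" and h: "continuous_on {a..b} h"
    and D: "\<And>z. a < z \<Longrightarrow> z < b \<Longrightarrow> \<exists>y. (E has_real_derivative y) (at z) \<and> y \<le> \<alpha> z * E z - h z"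
    and \<alpha>0: "\<And>z. z \<in> {a..b} \<Longrightarrow> 0 \<le> \<alpha> z" and h0: "\<And>z. z \<in> {a..b} \<Longrightarrow> 0 \<le> h z" and Eb: "0 \<le> E b"
  shows "integral {a..b} h \<le> exp (integral {a..b} \<alpha>) * E a"
proof -
  define P where "P = (\<lambda>z. integral {a..z} \<alpha>)"
  define Q where "Q = (\<lambda>z. integral {a..z} h)"
  define H where "H = (\<lambda>z. - exp (- P z) * E z - exp (- P b) * Q z)"
  have cP: "continuous_on {a..b} P" and cQ: "continuous_on {a..b} Q"
    unfolding P_def Q_def by (auto intro!: indefinite_integral_continuous_1 integrable_continuous_real \<alpha> h)
  have "H a \<le> H b"
  proof (rule nondecreasing_if_deriv_nonneg[OF ab])
    show "continuous_on {a..b} H" unfolding H_def by (intro continuous_intros cP cQ E)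
    fix z assume z: "a < z" "z < b"
    from D[OF z] obtain y where y: "(E has_real_derivative y) (at z)" "y \<le> \<alpha> z * E z - h z" by blast
    have dP: "(P has_real_derivative \<alpha> z) (at z)" and dQ: "(Q has_real_derivative h z) (at z)"
      unfolding P_def Q_def using integral_deriv_interior[OF \<alpha> z] integral_deriv_interior[OF h z] by auto
    have dH: "(H has_real_derivative exp (- P z) * (\<alpha> z * E z - y) - exp (- P b) * h z) (at z)"
      unfolding H_def by (rule derivative_eq_intros dP dQ y refl | simp add: algebra_simps)+
    have "P z \<le> P b"
      unfolding P_def
      by (rule integral_subset_le)
        (use z \<alpha>0 in \<open>auto intro!: integrable_continuous_real continuous_on_subset[OF \<alpha>]\<close>)
    then have "exp (- P b) * h z \<le> exp (- P z) * h z"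
      using h0 z by (intro mult_right_mono) auto
    also have "\<dots> \<le> exp (- P z) * (\<alpha> z * E z - y)" using y(2) by (intro mult_left_mono) auto
    finally have "0 \<le> exp (- P z) * (\<alpha> z * E z - y) - exp (- P b) * h z" by simp
    with dH show "\<exists>y\<ge>0. (H has_real_derivative y) (at z)" by blast
  qed
  then have "exp (- P b) * Q b \<le> E a - exp (- P b) * E b" by (simp add: H_def P_def Q_def)
  also have "\<dots> \<le> E a" using Eb by simp
  finally have "exp (P b) * (exp (- P b) * Q b) \<le> exp (P b) * E a" by (intro mult_left_mono) auto
  then show ?thesis by (simp add: P_def Q_def mult.assoc[symmetric] exp_add[symmetric])
qed

lemma weighted_sq_1: "weighted_sq 1 x = (norm x)\<^sup>2"
  unfolding power2_norm_eq_inner by (simp add: weighted_sq_def inner_vec_def power2_eq_square)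

lemma weighted_sq_4: "weighted_sq d (x :: real^4) = d $ 1 * (x $ 1)\<^sup>2 + d $ 2 * (x $ 2)\<^sup>2 + d $ 3 * (x $ 3)\<^sup>2 + d $ 4 * (x $ 4)\<^sup>2"
  by (simp add: weighted_sq_def sum_4)

lemma continuous_on_fibre_integral:
  fixes q :: "real \<times> real \<Rightarrow> real"
  assumes "C1_with (triangle Z) q qz qt" "1 \<le> s"
  shows "continuous_on {0..2 * Z / (1 + s)} (\<lambda>z. integral {z..2 * Z - s * z} (\<lambda>t. q (z, t)))"
  by (rule DERIV_continuous_on[OF deriv_fibre_integral[OF assms]])

section \<open>Bound of the regular part by the coefficient\<close>

text \<open>
  The lower order term of the system does no work. This is the reason why the size of a solution is
  controlled without any bound on \<open>\<beta>\<close> in the interior.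
\<close>

lemma matB_antisymmetric: "(\<Sum>i\<in>UNIV. x $ i * (matB c *v x) $ i) = 0"
  by (simp add: sum_4 matB_def matrix_vector_mult_def) (simp add: field_simps)

text \<open>
  Integrating \<open>(2 * Z - t) * ((norm m)\<^sup>2)\<^sub>t = (2 * Z - t) * (m \<bullet> A m)\<^sub>z\<close> over the triangle leaves the
  integral of \<open>(norm m)\<^sup>2\<close> and boundary terms. The factor \<open>2 * Z - t\<close> is nonnegative there, and the
  terms at \<open>z = 0\<close> and on the upper side have a favourable sign: at \<open>z = 0\<close> only the components moving
  out of the medium are nonzero, and the upper side is crossed outwards because no speed exceeds one.
  The front contributes at most \<open>2 * Z * g * \<beta>\<^sup>2\<close>. The computation is done fibrewise, with \<open>G z\<close> the
  weighted flux through the fibre at depth \<open>z\<close>.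
\<close>

lemma regular_part_L2_bound:
  assumes sol: "impulsive_solution c Z \<beta> m" and c: "0 < c" "c < 1" and Z: "0 < Z"
    and \<beta>: "continuous_on {0..Z} \<beta>"
  defines "g \<equiv> (1 - c)\<^sup>2 / (4 * (1 + c)) + (1 + c)\<^sup>2 / (4 * (1 - c))"
    and "N \<equiv> \<lambda>z. integral {z..2 * Z - z} (\<lambda>t. (norm (m (z, t)))\<^sup>2)"
  shows "continuous_on {0..Z} N" "integral {0..Z} N \<le> 2 * Z * g * integral {0..Z} (\<lambda>z. (\<beta> z)\<^sup>2)"
proof -
  from impulsive_solution_classical[OF sol c Z] obtain mz mt where
    m: "C1_with (triangle Z) m mz mt" and
    pde: "\<And>z t. 0 < z \<Longrightarrow> z < Z \<Longrightarrow> t \<in> {z..2 * Z - z} \<Longrightarrow>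
       mt (z, t) = matA c *v mz (z, t) + \<beta> z *\<^sub>R (matB c *v m (z, t))" and
    tr: "\<And>z. 0 < z \<Longrightarrow> z < Z \<Longrightarrow> m (z, z) $ 1 = 0"
    "\<And>z. 0 < z \<Longrightarrow> z < Z \<Longrightarrow> m (z, z) $ 3 = (c - 1) / (2 * (c + 1)) * \<beta> z"
    "\<And>z. 0 < z \<Longrightarrow> z < Z \<Longrightarrow> m (z, z) $ 4 = (c + 1) / (2 * (c - 1)) * \<beta> z" and
    bd: "\<And>t. t \<in> {0..2 * Z} \<Longrightarrow> m (0, t) $ 2 = 0" "\<And>t. t \<in> {0..2 * Z} \<Longrightarrow> m (0, t) $ 4 = 0"
    by blast
  show cN: "continuous_on {0..Z} N"
    using continuous_on_fibre_integral[OF C1_with_weighted_sq[OF m, of 1], of 1]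
    by (simp add: N_def weighted_sq_1)
  define G where "G = (\<lambda>z. integral {z..2 * Z - z} (\<lambda>t. (2 * Z - t) * weighted_sq (speed c) (m (z, t))))"
  have h: "C1_with (triangle Z) (\<lambda>p. 2 * Z - snd p) (\<lambda>p. 0) (\<lambda>p. -1)"
    by (rule C1_with_time_function[of "\<lambda>t. 2 * Z - t" "\<lambda>_. -1"]) (auto intro!: derivative_eq_intros)
  have cG: "continuous_on {0..Z} G"
    using continuous_on_fibre_integral[OF C1_with_mult[OF h C1_with_weighted_sq[OF m, of "speed c"]], of 1]
    by (simp add: G_def)
  have a0: "speed c $ i \<noteq> 0" for i
    using exhaust_4[of i] c by auto
  have e1: "(\<chi> i. 1) = (1 :: real^4)"
    by (simp add: vec_eq_iff)
  have dG: "\<exists>y. (G has_real_derivative y) (at z) \<and> N z - 2 * Z * g * (\<beta> z)\<^sup>2 \<le> y" if z: "0 < z" "z < Z" for z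
  proof -
    let ?u = "2 * Z - z" and ?v = "m (z, 2 * Z - z)" and ?x = "m (z, z)"
    define y where "y = z * (weighted_sq 1 ?v - weighted_sq (speed c) ?v)
        - (2 * Z - z) * (weighted_sq 1 ?x + weighted_sq (speed c) ?x) + N z"
    have "(G has_real_derivative
       (2 * Z + (-1) * (2 * Z - 1 * z)) * (weighted_sq 1 (m (z, 2 * Z - 1 * z)) - 1 * weighted_sq (speed c) (m (z, 2 * Z - 1 * z)))
      - (2 * Z + (-1) * z) * (weighted_sq 1 ?x + weighted_sq (speed c) ?x)
      - integral {z..2 * Z - 1 * z} (\<lambda>t. (-1) * weighted_sq 1 (m (z, t))
          + (2 * Z + (-1) * t) * (\<Sum>i\<in>UNIV. 2 * 1 $ i * m (z, t) $ i * (\<beta> z *\<^sub>R (matB c *v m (z, t))) $ i)))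
      (at z within {0..2 * Z / (1 + 1)})"
      using energy_identity[OF m, where s = 1 and z = z and a = "speed c" and d = "speed c" and l = "2 * Z" and k = "-1"
            and f = "\<lambda>t. \<beta> z *\<^sub>R (matB c *v m (z, t))"]
        a0 pde[OF z] z by (simp add: G_def e1 matA_nth)
    moreover have "(\<Sum>i\<in>UNIV. 2 * 1 $ i * x $ i * (\<beta> z *\<^sub>R (matB c *v x)) $ i) = 0" for x :: "real^4"
    proof -
      have "(\<Sum>i\<in>UNIV. 2 * 1 $ i * x $ i * (\<beta> z *\<^sub>R (matB c *v x)) $ i)
          = 2 * \<beta> z * (\<Sum>i\<in>UNIV. x $ i * (matB c *v x) $ i)"
        by (simp add: sum_distrib_left mult_ac)
      then show ?thesis by (simp only: matB_antisymmetric mult_zero_right)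
    qed
    ultimately have "(G has_real_derivative y) (at z)"
      using z by (simp add: at_within_Icc_at y_def N_def weighted_sq_1)
    moreover have "N z - 2 * Z * g * (\<beta> z)\<^sup>2 \<le> y"
    proof -
      have "speed c $ i \<le> 1" for i using exhaust_4[of i] c by auto
      then have "weighted_sq (speed c) ?v \<le> weighted_sq 1 ?v"
        unfolding weighted_sq_def by (intro sum_mono mult_right_mono) auto
      then have "0 \<le> z * (weighted_sq 1 ?v - weighted_sq (speed c) ?v)" using z by simp
      moreover have x: "weighted_sq 1 ?x + weighted_sq (speed c) ?x = g * (\<beta> z)\<^sup>2"
      proof -
        have q: "r * (a / (2 * r) * x)\<^sup>2 = a\<^sup>2 / (4 * r) * x\<^sup>2" if "r \<noteq> 0" for a r x :: real
          using that by (simp add: field_simps power2_eq_square)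
        have x4: "(1 - c) * (?x $ 4)\<^sup>2 = (1 + c)\<^sup>2 / (4 * (1 - c)) * (\<beta> z)\<^sup>2"
        proof -
          have "s * (a / (2 * (- s)) * x)\<^sup>2 = a\<^sup>2 / (4 * s) * x\<^sup>2" if "s \<noteq> 0" for a s x :: real
            using that by (simp add: field_simps power2_eq_square)
          from this[of "1 - c" "1 + c" "\<beta> z"] c show ?thesis
            by (simp only: tr(3)[OF z] minus_diff_eq add.commute[of c 1])
        qed
        have "weighted_sq 1 ?x + weighted_sq (speed c) ?x = (1 + c) * (?x $ 3)\<^sup>2 + (1 - c) * (?x $ 4)\<^sup>2"
          by (simp add: weighted_sq_4 tr(1)[OF z] algebra_simps)
        also have "(1 + c) * (?x $ 3)\<^sup>2 = (1 - c)\<^sup>2 / (4 * (1 + c)) * (\<beta> z)\<^sup>2"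
          using c q[of "1 + c" "c - 1" "\<beta> z"]
          by (simp only: tr(2)[OF z] add.commute[of c 1] power2_commute[of c 1])
        also have "(1 - c) * (?x $ 4)\<^sup>2 = (1 + c)\<^sup>2 / (4 * (1 - c)) * (\<beta> z)\<^sup>2"
          by (rule x4)
        finally show ?thesis by (simp add: g_def algebra_simps)
      qed
      moreover have "0 \<le> g * (\<beta> z)\<^sup>2" using c by (simp add: g_def)
      then have "(2 * Z - z) * (g * (\<beta> z)\<^sup>2) \<le> 2 * Z * (g * (\<beta> z)\<^sup>2)"
        using z by (intro mult_right_mono) auto
      ultimately show ?thesis by (simp add: y_def)
    qed
    ultimately show ?thesis by blast
  qed
  \<comment> \<open>Comparing \<open>J 0\<close> with \<open>J Z\<close> integrates the inequality \<open>dG\<close>, which holds at interior depths only.\<close>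
  define J where "J = (\<lambda>z. G z - integral {0..z} N + 2 * Z * g * integral {0..z} (\<lambda>z. (\<beta> z)\<^sup>2))"
  have c\<beta>: "continuous_on {0..Z} (\<lambda>z. (\<beta> z)\<^sup>2)" by (intro continuous_intros \<beta>)
  have "J 0 \<le> J Z"
  proof (rule nondecreasing_if_deriv_nonneg[of 0 Z J])
    show "continuous_on {0..Z} J" unfolding J_def
      by (intro continuous_intros cG indefinite_integral_continuous_1 integrable_continuous_real cN c\<beta>)
    fix z assume z: "0 < z" "z < Z"
    from dG[OF z] obtain y where y: "(G has_real_derivative y) (at z)" "N z - 2 * Z * g * (\<beta> z)\<^sup>2 \<le> y" by blast
    have "(J has_real_derivative y - N z + 2 * Z * g * (\<beta> z)\<^sup>2) (at z)"
      unfolding J_def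
      by (intro DERIV_add DERIV_diff DERIV_cmult y integral_deriv_interior[OF cN z] integral_deriv_interior[OF c\<beta> z])
    then show "\<exists>y\<ge>0. (J has_real_derivative y) (at z)" using y(2) by (intro exI conjI) auto
  qed (use Z in simp)
  moreover have "G Z = 0" by (simp add: G_def)
  moreover have "0 \<le> G 0"
    unfolding G_def
  proof (rule integral_nonneg)
    show "(\<lambda>t. (2 * Z - t) * weighted_sq (speed c) (m (0, t))) integrable_on {0..2 * Z - 0}"
      using continuous_on_fibre[OF C1_with_continuous(1)[OF C1_with_mult[OF h C1_with_weighted_sq[OF m, of "speed c"]]], of 1 0]
      by (auto intro: integrable_continuous_real)
    show "0 \<le> (2 * Z - t) * weighted_sq (speed c) (m (0, t))" if "t \<in> {0..2 * Z - 0}" for t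
      using bd[of t] that c by (auto simp: weighted_sq_4 intro!: mult_nonneg_nonneg add_nonneg_nonneg)
  qed
  ultimately show "integral {0..Z} N \<le> 2 * Z * g * integral {0..Z} (\<lambda>z. (\<beta> z)\<^sup>2)"
    by (simp add: J_def)
qed

section \<open>Energy estimate marching in depth\<close>

text \<open>
  The parameter \<open>M\<close> will be an upper bound of the integral of \<open>(norm n)\<^sup>2\<close> over a fibre. Dividing by
  \<open>2 * M\<close> in the last term ensures that its integral is at most \<open>b\<^sup>2 / 2\<close>, half of what the
  front dissipates, whatever the size of \<open>n\<close>.
\<close>

lemma forcing_young:
  fixes w n :: "'a::real_inner"
  assumes T: "bounded_linear T" "\<And>x. norm (T x) \<le> k * norm x" and k: "0 \<le> k" and M: "0 < M"
  shows "- (2 * (w \<bullet> T (\<beta> *\<^sub>R w + b *\<^sub>R n))) \<le> (k * (1 + \<beta>\<^sup>2) + 2 * k\<^sup>2 * M) * (norm w)\<^sup>2 + b\<^sup>2 / (2 * M) * (norm n)\<^sup>2"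
proof -
  have T': "T (\<beta> *\<^sub>R w + b *\<^sub>R n) = \<beta> *\<^sub>R T w + b *\<^sub>R T n"
    using T(1) by (simp add: linear_simps)
  have bound: "\<bar>w \<bullet> T x\<bar> \<le> k * norm w * norm x" for x
  proof -
    have "\<bar>w \<bullet> T x\<bar> \<le> norm w * norm (T x)" by (rule Cauchy_Schwarz_ineq2)
    also have "\<dots> \<le> norm w * (k * norm x)" by (intro mult_left_mono T) auto
    finally show ?thesis by (simp add: mult_ac)
  qed
  have 1: "- (2 * (\<beta> * (w \<bullet> T w))) \<le> k * (1 + \<beta>\<^sup>2) * (norm w)\<^sup>2"
  proof -
    have "- (2 * (\<beta> * (w \<bullet> T w))) \<le> (2 * \<bar>\<beta>\<bar>) * \<bar>w \<bullet> T w\<bar>"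
      by (metis abs_ge_minus_self abs_mult abs_numeral mult.assoc)
    also have "\<dots> \<le> (1 + \<beta>\<^sup>2) * (k * norm w * norm w)"
    proof (rule mult_mono[OF _ bound])
      show "2 * \<bar>\<beta>\<bar> \<le> 1 + \<beta>\<^sup>2" using zero_le_power2[of "\<bar>\<beta>\<bar> - 1"] by (simp add: power2_diff)
    qed auto
    finally show ?thesis by (simp add: power2_eq_square mult_ac)
  qed
  have 2: "- (2 * (b * (w \<bullet> T n))) \<le> 2 * k\<^sup>2 * M * (norm w)\<^sup>2 + b\<^sup>2 / (2 * M) * (norm n)\<^sup>2"
  proof -
    have "- (2 * (b * (w \<bullet> T n))) \<le> (2 * \<bar>b\<bar>) * \<bar>w \<bullet> T n\<bar>"
      by (metis abs_ge_minus_self abs_mult abs_numeral mult.assoc)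
    also have "\<dots> \<le> (2 * \<bar>b\<bar>) * (k * norm w * norm n)" by (intro mult_left_mono bound) auto
    also have "\<dots> \<le> 2 * k\<^sup>2 * M * (norm w)\<^sup>2 + b\<^sup>2 / (2 * M) * (norm n)\<^sup>2"
    proof -
      have "0 \<le> (2 * k * M * norm w - \<bar>b\<bar> * norm n)\<^sup>2 / (2 * M)" using M by simp
      also have "\<dots> = 2 * k\<^sup>2 * M * (norm w)\<^sup>2 + b\<^sup>2 / (2 * M) * (norm n)\<^sup>2 - (2 * \<bar>b\<bar>) * (k * norm w * norm n)"
        using M by (simp add: power2_diff field_simps power_mult_distrib) (simp add: power2_eq_square)
      finally show ?thesis by simp
    qed
    finally show ?thesis .
  qed
  show ?thesis using 1 2 by (simp add: T' inner_add_right algebra_simps)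
qed

text \<open>
  The weight of the third component in the marching energy; it is the solution of the linear
  equation \<open>lateral_weight_balance\<close>.
\<close>

definition lateral_weight :: "real \<Rightarrow> real" where
  "lateral_weight c = ((1 + c) ^ 3 + 4 * c * (1 - c\<^sup>2)) / (1 - c) ^ 3"

definition energy_weights :: "real \<Rightarrow> real^4" where
  "energy_weights c = vector [1, 1, lateral_weight c, 1]"

definition flux_weights :: "real \<Rightarrow> real^4" where
  "flux_weights c = (\<chi> i. energy_weights c $ i / speed c $ i)"

lemma energy_weights_simps [simp]:
  "energy_weights c $ 1 = 1" "energy_weights c $ 2 = 1"
  "energy_weights c $ 3 = lateral_weight c" "energy_weights c $ 4 = 1"
  by (simp_all add: energy_weights_def)

definition flux_weighted_B :: "real \<Rightarrow> real^4 \<Rightarrow> real^4" where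
  "flux_weighted_B c x = (\<chi> i. flux_weights c $ i * (matB c *v x) $ i)"

lemma bounded_linear_flux_weighted_B: "bounded_linear (flux_weighted_B c)"
proof -
  have "linear (flux_weighted_B c)"
    by (intro linearI)
       (auto simp: flux_weighted_B_def vec_eq_iff matrix_vector_right_distrib matrix_vector_mult_scaleR distrib_left)
  then show ?thesis by (rule linear_conv_bounded_linear[THEN iffD1])
qed

lemma lateral_weight_ge_1:
  assumes "0 < c" "c < 1" shows "1 \<le> lateral_weight c"
proof -
  have "(1 - c) ^ 3 \<le> (1 + c) ^ 3" using assms by (intro power_mono) auto
  moreover have "c\<^sup>2 \<le> 1" using assms by (simp add: power_le_one)
  then have "0 \<le> 4 * c * (1 - c\<^sup>2)" using assms by simp
  ultimately have "(1 - c) ^ 3 \<le> (1 + c) ^ 3 + 4 * c * (1 - c\<^sup>2)" by linarith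
  then show ?thesis using assms by (simp add: lateral_weight_def le_divide_eq)
qed

text \<open>
  The left side is the net energy that leaves through the front per unit of \<open>b\<^sup>2\<close>: the first component
  vanishes there and the second one moves along the front. The term of the fourth component is
  negative, as \<open>c < 1\<close>, and the weight of the third one compensates it.
\<close>

lemma lateral_weight_balance:
  assumes "0 < c" "c < 1"
  shows "lateral_weight c * (1 + 1 / c) * ((c - 1) / (2 * (c + 1)))\<^sup>2
    + (1 - 1 / c) * ((c + 1) / (2 * (c - 1)))\<^sup>2 = 1"
proof -
  define s where "s = 1 - c"
  define r where "r = 1 + c"
  have nz: "s \<noteq> 0" "r \<noteq> 0" "c \<noteq> 0" using assms by (auto simp: s_def r_def)
  have d: "1 - c\<^sup>2 = s * r" by (simp add: s_def r_def power2_eq_square algebra_simps)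
  have e: "1 + 1 / c = r / c" "c - 1 = - s" "c + 1 = r" "lateral_weight c = (r ^ 3 + 4 * c * (s * r)) / s ^ 3"
    using nz unfolding lateral_weight_def d by (simp_all add: r_def s_def field_simps)
  have "lateral_weight c * (1 + 1 / c) * ((c - 1) / (2 * (c + 1)))\<^sup>2 = (r ^ 3 + 4 * c * (s * r)) / s ^ 3 * (r / c) * (s\<^sup>2 / (4 * r\<^sup>2))"
    by (simp only: e power_divide power_mult_distrib power2_minus) simp
  also have "\<dots> = r\<^sup>2 / (4 * c * s) + 1"
    using nz by (simp add: field_simps power2_eq_square power3_eq_cube)
  moreover have "(1 - 1 / c) * ((c + 1) / (2 * (c - 1)))\<^sup>2 = - (r\<^sup>2 / (4 * c * s))"
  proof -
    have "(1 - 1 / c) * ((c + 1) / (2 * (c - 1)))\<^sup>2 = (- s / c) * (r / (2 * (- s)))\<^sup>2"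
      using nz by (simp add: s_def r_def field_simps)
    also have "\<dots> = - (r\<^sup>2 / (4 * c * s))"
      using nz by (simp add: field_simps power2_eq_square)
    finally show ?thesis .
  qed
  ultimately show ?thesis by simp
qed

text \<open>
  In the derivative of \<open>E\<close>, the flux through the upper end is nonpositive since \<open>1 / c\<close> is the largest
  of the values \<open>1 / speed c $ i\<close>; the front contributes \<open>- (\<beta>1 z - \<beta>2 z)\<^sup>2\<close>, and the forcing gives half
  of this back. The source term contains only the solution \<open>m2\<close>, by writing
  \<open>\<beta>1 m1 - \<beta>2 m2 = \<beta>1 (m1 - m2) + (\<beta>1 - \<beta>2) m2\<close>.
\<close>

lemma lateral_energy_inequality:
  assumes c: "0 < c" "c < 1" and Z: "0 < Z"
    and sol1: "impulsive_solution c Z \<beta>1 m1" and sol2: "impulsive_solution c Z \<beta>2 m2"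
    and k: "0 \<le> k" "\<And>x. norm (flux_weighted_B c x) \<le> k * norm x"
  defines "Y \<equiv> 2 * c * Z / (1 + c)" and "d \<equiv> energy_weights c"
  defines "N \<equiv> \<lambda>z. integral {z..2 * Z - z} (\<lambda>t. (norm (m2 (z, t)))\<^sup>2)"
    and "E \<equiv> \<lambda>z. integral {z..2 * Z - 1 / c * z} (\<lambda>t. weighted_sq d (m1 (z, t) - m2 (z, t)))"
  shows "continuous_on {0..Y} E"
    and "\<And>z. 0 < z \<Longrightarrow> z < Y \<Longrightarrow> \<exists>y. (E has_real_derivative y) (at z) \<and>
      y \<le> (k * (1 + (\<beta>1 z)\<^sup>2) + 2 * k\<^sup>2 * (N z + 1)) * E z - (\<beta>1 z - \<beta>2 z)\<^sup>2 / 2"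
    and "\<And>z. 0 \<le> z \<Longrightarrow> 0 \<le> E z"
    and "E 0 \<le> lateral_weight c * (integral {0..2 * Z} (\<lambda>t. (m1 (0, t) $ 1 - m2 (0, t) $ 1)\<^sup>2)
      + integral {0..2 * Z} (\<lambda>t. (m1 (0, t) $ 3 - m2 (0, t) $ 3)\<^sup>2))"
proof -
  from impulsive_solution_classical[OF sol1 c Z] obtain m1z m1t where
    m1: "C1_with (triangle Z) m1 m1z m1t" and
    pde1: "\<And>z t. 0 < z \<Longrightarrow> z < Z \<Longrightarrow> t \<in> {z..2 * Z - z} \<Longrightarrow>
       m1t (z, t) = matA c *v m1z (z, t) + \<beta>1 z *\<^sub>R (matB c *v m1 (z, t))" and
    tr1: "\<And>z. 0 < z \<Longrightarrow> z < Z \<Longrightarrow> m1 (z, z) $ 1 = 0"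
    "\<And>z. 0 < z \<Longrightarrow> z < Z \<Longrightarrow> m1 (z, z) $ 3 = (c - 1) / (2 * (c + 1)) * \<beta>1 z"
    "\<And>z. 0 < z \<Longrightarrow> z < Z \<Longrightarrow> m1 (z, z) $ 4 = (c + 1) / (2 * (c - 1)) * \<beta>1 z" and
    bd1: "\<And>t. t \<in> {0..2 * Z} \<Longrightarrow> m1 (0, t) $ 2 = 0" "\<And>t. t \<in> {0..2 * Z} \<Longrightarrow> m1 (0, t) $ 4 = 0"
    by blast
  from impulsive_solution_classical[OF sol2 c Z] obtain m2z m2t where
    m2: "C1_with (triangle Z) m2 m2z m2t" and
    pde2: "\<And>z t. 0 < z \<Longrightarrow> z < Z \<Longrightarrow> t \<in> {z..2 * Z - z} \<Longrightarrow>
       m2t (z, t) = matA c *v m2z (z, t) + \<beta>2 z *\<^sub>R (matB c *v m2 (z, t))" and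
    tr2: "\<And>z. 0 < z \<Longrightarrow> z < Z \<Longrightarrow> m2 (z, z) $ 1 = 0"
    "\<And>z. 0 < z \<Longrightarrow> z < Z \<Longrightarrow> m2 (z, z) $ 3 = (c - 1) / (2 * (c + 1)) * \<beta>2 z"
    "\<And>z. 0 < z \<Longrightarrow> z < Z \<Longrightarrow> m2 (z, z) $ 4 = (c + 1) / (2 * (c - 1)) * \<beta>2 z" and
    bd2: "\<And>t. t \<in> {0..2 * Z} \<Longrightarrow> m2 (0, t) $ 2 = 0" "\<And>t. t \<in> {0..2 * Z} \<Longrightarrow> m2 (0, t) $ 4 = 0"
    by blast
  define w where "w = (\<lambda>p. m1 p - m2 p)"
  define b where "b = (\<lambda>z. \<beta>1 z - \<beta>2 z)"
  define e where "e = flux_weights c"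
  have w: "C1_with (triangle Z) w (\<lambda>p. m1z p - m2z p) (\<lambda>p. m1t p - m2t p)"
    unfolding w_def by (rule C1_with_diff[OF m1 m2])
  have s: "1 \<le> 1 / c" using c by simp
  have Y: "2 * Z / (1 + 1 / c) = Y" using c by (simp add: Y_def field_simps)
  have YZ: "Y < Z" using c Z by (simp add: Y_def field_simps)
  have a0: "speed c $ i \<noteq> 0" for i using exhaust_4[of i] c by auto
  have d_simps: "d $ 1 = 1" "d $ 2 = 1" "d $ 3 = lateral_weight c" "d $ 4 = 1" by (simp_all add: d_def)
  have e: "e = (\<chi> i. d $ i / speed c $ i)" by (simp add: e_def d_def flux_weights_def)
  note \<delta>1 = lateral_weight_ge_1[OF c]
  have d1: "1 \<le> d $ i" for i using exhaust_4[of i] \<delta>1 by (auto simp: d_simps)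
  have norm_le: "(norm x)\<^sup>2 \<le> weighted_sq d x" for x
  proof -
    have "weighted_sq 1 x \<le> weighted_sq d x"
      unfolding weighted_sq_def by (intro sum_mono mult_right_mono) (auto simp: d1)
    then show ?thesis by (simp add: weighted_sq_1)
  qed
  have wd0: "0 \<le> weighted_sq d x" for x
    using norm_le[of x] zero_le_power2 order_trans by blast
  have E: "E = (\<lambda>z. integral {z..2 * Z - 1 / c * z} (\<lambda>t. weighted_sq d (w (z, t))))"
    by (simp add: E_def w_def)
  note qw = C1_with_weighted_sq[OF w, of d]
  have int_w: "(\<lambda>t. weighted_sq d (w (z, t))) integrable_on {z..2 * Z - 1 / c * z}" if "0 \<le> z" for z
    using continuous_on_fibre[OF C1_with_continuous(1)[OF qw] s that] by (rule integrable_continuous_real)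
  show "continuous_on {0..Y} E"
    using continuous_on_fibre_integral[OF qw s] by (simp only: E Y)
  show "0 \<le> E z" if "0 \<le> z" for z
    unfolding E by (rule integral_nonneg[OF int_w[OF that] wd0])
  show "E 0 \<le> lateral_weight c * (integral {0..2 * Z} (\<lambda>t. (m1 (0, t) $ 1 - m2 (0, t) $ 1)\<^sup>2)
      + integral {0..2 * Z} (\<lambda>t. (m1 (0, t) $ 3 - m2 (0, t) $ 3)\<^sup>2))"
  proof -
    have i: "(\<lambda>t. (w (0, t) $ i)\<^sup>2) integrable_on {0..2 * Z}" for i
      using continuous_on_fibre[OF C1_with_continuous(1)[OF C1_with_component[OF w]], of 1 0 i]
      by (intro integrable_continuous_real continuous_on_power) auto
    have "E 0 = integral {0..2 * Z} (\<lambda>t. weighted_sq d (w (0, t)))" by (simp add: E)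
    also have "\<dots> \<le> integral {0..2 * Z} (\<lambda>t. lateral_weight c * ((w (0, t) $ 1)\<^sup>2 + (w (0, t) $ 3)\<^sup>2))"
    proof (rule integral_le)
      show "(\<lambda>t. weighted_sq d (w (0, t))) integrable_on {0..2 * Z}" using int_w[of 0] by simp
      show "(\<lambda>t. lateral_weight c * ((w (0, t) $ 1)\<^sup>2 + (w (0, t) $ 3)\<^sup>2)) integrable_on {0..2 * Z}"
        by (intro integrable_on_mult_right integrable_add i)
      fix t assume "t \<in> {0..2 * Z}"
      then have "w (0, t) $ 2 = 0" "w (0, t) $ 4 = 0" using bd1 bd2 by (auto simp: w_def)
      moreover have "(w (0, t) $ 1)\<^sup>2 \<le> lateral_weight c * (w (0, t) $ 1)\<^sup>2"
        using mult_right_mono[OF \<delta>1, of "(w (0, t) $ 1)\<^sup>2"] by simp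
      ultimately show "weighted_sq d (w (0, t)) \<le> lateral_weight c * ((w (0, t) $ 1)\<^sup>2 + (w (0, t) $ 3)\<^sup>2)"
        by (simp add: weighted_sq_4 d_simps distrib_left)
    qed
    also have "\<dots> = lateral_weight c * (integral {0..2 * Z} (\<lambda>t. (w (0, t) $ 1)\<^sup>2) + integral {0..2 * Z} (\<lambda>t. (w (0, t) $ 3)\<^sup>2))"
      by (simp only: integral_mult_right integral_add[OF i i])
    finally show ?thesis by (simp add: w_def)
  qed
  fix z assume z: "0 < z" "z < Y"
  then have zZ: "z < Z" using YZ by simp
  define u where "u = 2 * Z - 1 / c * z"
  \<comment> \<open>Adding one keeps \<open>M\<close> positive when \<open>m2\<close> vanishes on the fibre.\<close>
  define M where "M = N z + 1"
  define f where "f = (\<lambda>t. \<beta>1 z *\<^sub>R (matB c *v w (z, t)) + b z *\<^sub>R (matB c *v m2 (z, t)))"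
  define F where "F = (\<lambda>t. \<Sum>i\<in>UNIV. 2 * e $ i * w (z, t) $ i * f t $ i)"
  have u: "u \<le> 2 * Z - z"
  proof -
    have "z \<le> 1 / c * z" using c z by (simp add: field_simps)
    then show ?thesis by (simp add: u_def)
  qed
  have eq: "(m1t (z, t) - m2t (z, t)) $ i = speed c $ i * (m1z (z, t) - m2z (z, t)) $ i + f t $ i"
    if "t \<in> {z..u}" for t i
  proof -
    have t: "t \<in> {z..2 * Z - z}" using that u by auto
    show ?thesis
      using pde1[OF z(1) zZ t] pde2[OF z(1) zZ t]
      by (simp add: matA_nth f_def w_def b_def matrix_vector_mult_diff_distrib algebra_simps)
  qed
  have "(E has_real_derivative
      (1 + 0 * u) * (weighted_sq e (w (z, u)) - 1 / c * weighted_sq d (w (z, u)))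
      - (1 + 0 * z) * (weighted_sq e (w (z, z)) + weighted_sq d (w (z, z)))
      - integral {z..u} (\<lambda>t. 0 * weighted_sq e (w (z, t)) + (1 + 0 * t) * F t))
      (at z within {0..Y})"
    using energy_identity[OF w s, where z = z and a = "speed c" and d = d and l = 1 and k = 0 and f = f]
      eq a0 z unfolding Y by (simp add: E e F_def u_def)
  then have dE: "(E has_real_derivative
      (weighted_sq e (w (z, u)) - 1 / c * weighted_sq d (w (z, u)))
      - (weighted_sq e (w (z, z)) + weighted_sq d (w (z, z))) - integral {z..u} F) (at z)"
    using z by (simp add: at_within_Icc_at)
  \<comment> \<open>No component enters through the upper end: the third one moves along it, the others leave.\<close>
  have top: "weighted_sq e x - 1 / c * weighted_sq d x \<le> 0" for x
  proof -
    have "e $ i \<le> 1 / c * d $ i" for i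
    proof -
      have "1 / speed c $ i \<le> 1 / c" using exhaust_4[of i] c by (auto intro: order_trans[of _ 0])
      then have "d $ i * (1 / speed c $ i) \<le> d $ i * (1 / c)" using d1[of i] by (intro mult_left_mono) auto
      then show ?thesis by (simp add: e)
    qed
    then have "weighted_sq e x \<le> (\<Sum>i\<in>UNIV. 1 / c * d $ i * (x $ i)\<^sup>2)"
      unfolding weighted_sq_def by (intro sum_mono mult_right_mono) auto
    then show ?thesis by (simp add: weighted_sq_def sum_distrib_left mult.assoc)
  qed
  have diag: "weighted_sq e (w (z, z)) + weighted_sq d (w (z, z)) = (b z)\<^sup>2"
  proof -
    have w': "w (z, z) $ 1 = 0" "w (z, z) $ 3 = (c - 1) / (2 * (c + 1)) * b z"
       "w (z, z) $ 4 = (c + 1) / (2 * (c - 1)) * b z"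
      using tr1[OF z(1) zZ] tr2[OF z(1) zZ] by (simp_all add: w_def b_def right_diff_distrib)
    have "weighted_sq e (w (z, z)) + weighted_sq d (w (z, z))
      = lateral_weight c * (1 + 1 / c) * (w (z, z) $ 3)\<^sup>2 + (1 - 1 / c) * (w (z, z) $ 4)\<^sup>2"
      by (simp add: weighted_sq_4 e d_simps w'(1) algebra_simps)
    also have "\<dots> = (lateral_weight c * (1 + 1 / c) * ((c - 1) / (2 * (c + 1)))\<^sup>2
        + (1 - 1 / c) * ((c + 1) / (2 * (c - 1)))\<^sup>2) * (b z)\<^sup>2"
      by (simp only: w' power_mult_distrib distrib_right mult.assoc)
    finally show ?thesis by (simp only: lateral_weight_balance[OF c] mult_1_left)
  qed
  define A where "A = k * (1 + (\<beta>1 z)\<^sup>2) + 2 * k\<^sup>2 * M"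
  have cm2: "continuous_on {z..2 * Z - z} (\<lambda>t. m2 (z, t))"
    using continuous_on_fibre[OF C1_with_continuous(1)[OF m2], of 1 z] z by simp
  have int_n: "(\<lambda>t. (norm (m2 (z, t)))\<^sup>2) integrable_on {z..2 * Z - z}"
    by (intro integrable_continuous_real continuous_intros cm2)
  have int_n': "(\<lambda>t. (norm (m2 (z, t)))\<^sup>2) integrable_on {z..u}"
    by (rule integrable_on_subinterval[OF int_n]) (use u in auto)
  have nN: "integral {z..u} (\<lambda>t. (norm (m2 (z, t)))\<^sup>2) \<le> N z"
    unfolding N_def by (rule integral_subset_le) (use u int_n int_n' in auto)
  have N0: "0 \<le> N z" unfolding N_def by (rule integral_nonneg[OF int_n]) auto
  have M0: "0 < M" using N0 by (simp add: M_def)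
  have "integral {z..u} (\<lambda>t. - F t) \<le> integral {z..u} (\<lambda>t. A * weighted_sq d (w (z, t)) + (b z)\<^sup>2 / (2 * M) * (norm (m2 (z, t)))\<^sup>2)"
  proof (rule integral_le)
    have cw: "continuous_on {z..u} (\<lambda>t. w (z, t))"
      using continuous_on_fibre[OF C1_with_continuous(1)[OF w] s, of z] z by (simp add: u_def)
    have "continuous_on {z..u} f"
      unfolding f_def using u
      by (intro continuous_intros continuous_on_matrix_vector cw continuous_on_subset[OF cm2]) auto
    then show "(\<lambda>t. - F t) integrable_on {z..u}"
      unfolding F_def by (intro integrable_continuous_real continuous_intros cw)
    show "(\<lambda>t. A * weighted_sq d (w (z, t)) + (b z)\<^sup>2 / (2 * M) * (norm (m2 (z, t)))\<^sup>2) integrable_on {z..u}"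
      using int_w[of z] z int_n' by (intro integrable_add integrable_on_mult_right) (auto simp: u_def)
    fix t assume "t \<in> {z..u}"
    have "F t = 2 * (w (z, t) \<bullet> flux_weighted_B c (\<beta>1 z *\<^sub>R w (z, t) + b z *\<^sub>R m2 (z, t)))"
      by (simp add: F_def f_def flux_weighted_B_def e_def inner_vec_def sum_distrib_left matrix_vector_right_distrib matrix_vector_mult_scaleR mult_ac)
    then have "- F t \<le> A * (norm (w (z, t)))\<^sup>2 + (b z)\<^sup>2 / (2 * M) * (norm (m2 (z, t)))\<^sup>2"
      using forcing_young[OF bounded_linear_flux_weighted_B k(2,1), OF M0, of "w (z, t)" "\<beta>1 z" "b z" "m2 (z, t)"] by (simp add: A_def)
    also have "A * (norm (w (z, t)))\<^sup>2 \<le> A * weighted_sq d (w (z, t))"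
      using k N0 by (intro mult_left_mono norm_le) (auto simp: A_def M_def intro!: add_nonneg_nonneg mult_nonneg_nonneg)
    finally show "- F t \<le> A * weighted_sq d (w (z, t)) + (b z)\<^sup>2 / (2 * M) * (norm (m2 (z, t)))\<^sup>2" by simp
  qed
  also have "\<dots> = A * E z + (b z)\<^sup>2 / (2 * M) * integral {z..u} (\<lambda>t. (norm (m2 (z, t)))\<^sup>2)"
    by (intro integral_unique has_integral_add has_integral_mult_right)
       (use int_w[of z] z int_n' in \<open>auto simp: u_def E\<close>)
  also have "\<dots> \<le> A * E z + (b z)\<^sup>2 / 2"
  proof -
    have "(b z)\<^sup>2 / (2 * M) * integral {z..u} (\<lambda>t. (norm (m2 (z, t)))\<^sup>2) \<le> (b z)\<^sup>2 / (2 * M) * M"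
      using nN N0 by (intro mult_left_mono) (auto simp: M_def)
    also have "(b z)\<^sup>2 / (2 * M) * M = (b z)\<^sup>2 / 2" using M0 by simp
    finally show ?thesis by simp
  qed
  finally have "- integral {z..u} F \<le> A * E z + (b z)\<^sup>2 / 2" by simp
  with top[of "w (z, u)"] diag
  have "(weighted_sq e (w (z, u)) - 1 / c * weighted_sq d (w (z, u)))
      - (weighted_sq e (w (z, z)) + weighted_sq d (w (z, z))) - integral {z..u} F
    \<le> A * E z - (b z)\<^sup>2 / 2" by linarith
  with dE show "\<exists>y. (E has_real_derivative y) (at z) \<and>
      y \<le> (k * (1 + (\<beta>1 z)\<^sup>2) + 2 * k\<^sup>2 * (N z + 1)) * E z - (\<beta>1 z - \<beta>2 z)\<^sup>2 / 2"
    unfolding A_def M_def b_def by blast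
qed

section \<open>Stability of the inverse problem\<close>

lemma C1_dot_continuous: "\<beta> \<in> C1_dot Z \<Longrightarrow> continuous_on {0..Z} \<beta>"
  unfolding C1_dot_def by (auto intro: DERIV_continuous_on)

lemma L2_norm_on_square: "(L2_norm_on a b f)\<^sup>2 = integral {a..b} (\<lambda>x. (f x)\<^sup>2)"
proof -
  have "0 \<le> integral {a..b} (\<lambda>x. (f x)\<^sup>2)"
    by (cases "(\<lambda>x. (f x)\<^sup>2) integrable_on {a..b}") (auto intro: integral_nonneg simp: not_integrable_integral)
  then show ?thesis by (simp add: L2_norm_on_def)
qed

theorem theorem1p2:
  fixes c Z K Y :: real
  assumes "0 < c" and "c < 1" and "0 < Z" and "0 < K"
    and "Y = 2 * c * Z / (1 + c)"
  shows "\<exists>C::real. \<forall>\<beta> \<beta>' m m'.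
    \<beta> \<in> C1_dot Z \<longrightarrow> \<beta>' \<in> C1_dot Z \<longrightarrow>
    (L2_norm_on 0 Z \<beta>)\<^sup>2 \<le> K \<longrightarrow> (L2_norm_on 0 Z \<beta>')\<^sup>2 \<le> K \<longrightarrow>
    impulsive_solution c Z \<beta> m \<longrightarrow> impulsive_solution c Z \<beta>' m' \<longrightarrow>
    (L2_norm_on 0 Y (\<lambda>z. \<beta> z - \<beta>' z))\<^sup>2 \<le>
      C * ((L2_norm_on 0 (2 * Z) (\<lambda>t. m (0, t) $ 1 - m' (0, t) $ 1))\<^sup>2 +
           (L2_norm_on 0 (2 * Z) (\<lambda>t. m (0, t) $ 3 - m' (0, t) $ 3))\<^sup>2)"
proof -
  note c = assms(1,2) and Z = assms(3)
  obtain k where k: "0 \<le> k" "\<And>x. norm (flux_weighted_B c x) \<le> k * norm x"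
    using bounded_linear.nonneg_bounded[OF bounded_linear_flux_weighted_B[of c]] by (metis mult.commute)
  define g where "g = (1 - c)\<^sup>2 / (4 * (1 + c)) + (1 + c)\<^sup>2 / (4 * (1 - c))"
  have g: "0 \<le> g" using c by (simp add: g_def)
  define R where "R = k * (Z + K) + 2 * k\<^sup>2 * (2 * Z * g * K + Z)"
  have YZ: "Y < Z" and Y0: "0 < Y" using c Z by (auto simp: assms(5) field_simps)
  show ?thesis
  proof (intro exI[of _ "2 * exp R * lateral_weight c"] allI impI)
    fix \<beta> \<beta>' :: "real \<Rightarrow> real" and m m' :: "real \<times> real \<Rightarrow> real^4"
    assume \<beta>: "\<beta> \<in> C1_dot Z" and \<beta>': "\<beta>' \<in> C1_dot Z"
      and K: "(L2_norm_on 0 Z \<beta>)\<^sup>2 \<le> K" "(L2_norm_on 0 Z \<beta>')\<^sup>2 \<le> K"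
      and sol: "impulsive_solution c Z \<beta> m" and sol': "impulsive_solution c Z \<beta>' m'"
    note cont = C1_dot_continuous[OF \<beta>] C1_dot_continuous[OF \<beta>']
    define N where "N = (\<lambda>z. integral {z..2 * Z - z} (\<lambda>t. (norm (m' (z, t)))\<^sup>2))"
    define E where "E = (\<lambda>z. integral {z..2 * Z - 1 / c * z} (\<lambda>t. weighted_sq (energy_weights c) (m (z, t) - m' (z, t))))"
    define \<alpha> where "\<alpha> = (\<lambda>z. k * (1 + (\<beta> z)\<^sup>2) + 2 * k\<^sup>2 * (N z + 1))"
    define D where "D = integral {0..2 * Z} (\<lambda>t. (m (0, t) $ 1 - m' (0, t) $ 1)\<^sup>2)
      + integral {0..2 * Z} (\<lambda>t. (m (0, t) $ 3 - m' (0, t) $ 3)\<^sup>2)"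
    note energy = lateral_energy_inequality[OF c Z sol sol' k, folded assms(5) N_def E_def D_def]
    note L2 = regular_part_L2_bound[OF sol' c Z cont(2), folded g_def N_def]
    have N0: "0 \<le> N z" for z
      unfolding N_def
      by (cases "(\<lambda>t. (norm (m' (z, t)))\<^sup>2) integrable_on {z..2 * Z - z}")
         (auto intro: integral_nonneg simp: not_integrable_integral)
    have \<alpha>0: "0 \<le> \<alpha> z" for z using k N0[of z] by (simp add: \<alpha>_def)
    have c\<alpha>: "continuous_on {0..Z} \<alpha>"
      unfolding \<alpha>_def by (intro continuous_intros cont L2(1))
    have sub: "{0..Y} \<subseteq> {0..Z}" using YZ by auto
    have i\<beta>: "((\<lambda>z. (\<beta> z)\<^sup>2) has_integral integral {0..Z} (\<lambda>z. (\<beta> z)\<^sup>2)) {0..Z}"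
      by (intro integrable_integral integrable_continuous_real continuous_intros cont)
    have iN: "(N has_integral integral {0..Z} N) {0..Z}"
      by (intro integrable_integral integrable_continuous_real L2(1))
    have i1: "((\<lambda>z. 1 :: real) has_integral Z) {0..Z}" using has_integral_const_real[of "1 :: real" 0 Z] Z by simp
    have "integral {0..Y} \<alpha> \<le> integral {0..Z} \<alpha>"
      by (rule integral_subset_le)
         (use sub \<alpha>0 in \<open>auto intro!: integrable_continuous_real c\<alpha> continuous_on_subset[OF c\<alpha>]\<close>)
    also have "\<dots> = k * (Z + integral {0..Z} (\<lambda>z. (\<beta> z)\<^sup>2)) + 2 * k\<^sup>2 * (integral {0..Z} N + Z)"
      unfolding \<alpha>_def
      by (rule integral_unique)
         (intro has_integral_add has_integral_mult_right i1 i\<beta> iN)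
    also have "\<dots> \<le> R"
    proof -
      have "integral {0..Z} N \<le> 2 * Z * g * K"
        by (rule order_trans[OF L2(2)], rule mult_left_mono)
           (use K(2) g Z in \<open>auto simp: L2_norm_on_square\<close>)
      then show ?thesis
        using k K(1) unfolding R_def by (intro add_mono mult_left_mono) (auto simp: L2_norm_on_square)
    qed
    finally have \<alpha>R: "integral {0..Y} \<alpha> \<le> R" .
    have "integral {0..Y} (\<lambda>z. (\<beta> z - \<beta>' z)\<^sup>2 / 2) \<le> exp (integral {0..Y} \<alpha>) * E 0"
    proof (rule gronwall_dissipation)
      show "continuous_on {0..Y} (\<lambda>z. (\<beta> z - \<beta>' z)\<^sup>2 / 2)"
        by (intro continuous_intros continuous_on_subset[OF cont(1) sub] continuous_on_subset[OF cont(2) sub]) auto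
      show "\<exists>y. (E has_real_derivative y) (at z) \<and> y \<le> \<alpha> z * E z - (\<beta> z - \<beta>' z)\<^sup>2 / 2" if "0 < z" "z < Y" for z
        using energy(2)[OF that] by (simp only: \<alpha>_def N_def E_def)
      show "0 \<le> E Y" using energy(3)[of Y] Y0 by (simp only: E_def less_imp_le)
    qed (use Y0 energy(1) \<alpha>0 continuous_on_subset[OF c\<alpha> sub] in auto)
    also have "\<dots> \<le> exp R * (lateral_weight c * D)"
    proof (rule mult_mono)
      show "0 \<le> E 0" using energy(3)[OF order_refl] by (simp only: E_def)
      show "E 0 \<le> lateral_weight c * D" using energy(4) by (simp only: E_def)
    qed (use \<alpha>R in auto)
    finally have "integral {0..Y} (\<lambda>z. (\<beta> z - \<beta>' z)\<^sup>2) \<le> 2 * exp R * lateral_weight c * D"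
      by simp
    then show "(L2_norm_on 0 Y (\<lambda>z. \<beta> z - \<beta>' z))\<^sup>2 \<le> 2 * exp R * lateral_weight c *
      ((L2_norm_on 0 (2 * Z) (\<lambda>t. m (0, t) $ 1 - m' (0, t) $ 1))\<^sup>2 +
       (L2_norm_on 0 (2 * Z) (\<lambda>t. m (0, t) $ 3 - m' (0, t) $ 3))\<^sup>2)"
      by (simp only: L2_norm_on_square D_def)
  qed
qed

end
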